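(* Let $\mathfrak{g}$ be a seven-dimensional real almost Abelian Lie algebra and $\mathfrak{u}$ a six-dimensional Abelian ideal of $\mathfrak{g}$. The following are equivalent: (i) $\mathfrak{g}$ admits a calibrated $\mathrm{G}_2$-structure; (ii) $\mathfrak{g}$ admits a calibrated $\mathrm{G}_2^*$-structure $\varphi$ such that $\mathfrak{u}$ has signature $(2,4)$ with respect to $g_\varphi$; (iii) for any $f_7\in\mathfrak{g}\setminus\mathfrak{u}$ there exist $A,B\in\mathfrak{sl}(3,\mathbb{R})$ and an ordered basis $(f_1,\dots,f_6)$ of $\mathfrak{u}$ such that the matrix of $\mathrm{ad}(f_7)|_{\mathfrak{u}}$ with respect to it is $\begin{pmatrix}A&B\\-B&A\end{pmatrix}$; (iv) for any $f_7\in\mathfrak{g}\setminus\mathfrak{u}$, the complex Jordan normal form of $\mathrm{ad}(f_7)|_{\mathfrak{u}}$ is, up to permutation of the Jordan blocks, $\mathrm{diag}(J,\overline{J})$ for some trace-free matrix $J\in\mathbb{C}^{3\times3}$ in complex Jordan normal form.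
   Context: For $\epsilon\in\{-1,1\}$ let $\varphi_\epsilon:=-\epsilon(e^{127}+e^{347})+e^{567}+e^{135}-e^{146}-e^{236}-e^{245}\in\Lambda^3(\mathbb{R}^7)^*$ ($e^{ijk}=e^i\wedge e^j\wedge e^k$). A three-form $\varphi$ on a seven-dimensional real vector space $V$ is a $\mathrm{G}_2^{\epsilon}$-structure if $f^*\varphi_\epsilon=\varphi$ for some linear isomorphism $f:V\to\mathbb{R}^7$ ($\mathrm{G}_2$-structure for $\epsilon=-1$, $\mathrm{G}_2^*$-structure for $\epsilon=1$); it induces a pseudo-Euclidean metric $g_\varphi$ (positive definite for $\epsilon=-1$, of signature $(3,4)$ for $\epsilon=1$), determined by $g_\varphi(v,w)\,\mathrm{vol}=\frac16(v\lrcorner\varphi)\wedge(w\lrcorner\varphi)\wedge\varphi$ with vol the metric volume form, and a Hodge star $\star_\varphi$. For a Lie algebra $\mathfrak{g}$, $d:\Lambda^\bullet\mathfrak{g}^*\to\Lambda^{\bullet+1}\mathfrak{g}^*$ is the derivation with $(d\alpha)(X,Y)=-\alpha([X,Y])$ for $\alpha\in\mathfrak{g}^*$. A $\mathrm{G}_2^\epsilon$-structure $\varphi$ on $\mathfrak{g}$ is calibrated if $d\varphi=0$. A Lie algebra is almost Abelian if it has a codimension-one Abelian ideal. *)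

theory Defs
  imports "HOL-Analysis.Analysis" "HOL-Combinatorics.Permutations"
    "Jordan_Normal_Form.Jordan_Normal_Form"
begin

definition lie_algebra :: "('a::real_vector \<Rightarrow> 'a \<Rightarrow> 'a) \<Rightarrow> bool" where
  "lie_algebra br \<longleftrightarrow>
     (\<forall>x. linear (br x)) \<and> (\<forall>y. linear (\<lambda>x. br x y)) \<and>
     (\<forall>x y. br x y = - br y x) \<and>
     (\<forall>x y z. br x (br y z) + br y (br z x) + br z (br x y) = 0)"

definition abelian_ideal :: "('a::real_vector \<Rightarrow> 'a \<Rightarrow> 'a) \<Rightarrow> 'a set \<Rightarrow> bool" where
  "abelian_ideal br u \<longleftrightarrow> subspace u \<and> (\<forall>x y. y \<in> u \<longrightarrow> br x y \<in> u) \<and>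
     (\<forall>x\<in>u. \<forall>y\<in>u. br x y = 0)"

definition almost_abelian :: "('a::euclidean_space \<Rightarrow> 'a \<Rightarrow> 'a) \<Rightarrow> bool" where
  "almost_abelian br \<longleftrightarrow> (\<exists>u. abelian_ideal br u \<and> dim u + 1 = DIM('a))"

text \<open>A k-form is represented as a function of a sequence of vectors (only the first k
  entries are used).  Wedge product with the determinant convention.\<close>

definition wedge :: "nat \<Rightarrow> nat \<Rightarrow> ((nat \<Rightarrow> 'v) \<Rightarrow> real) \<Rightarrow> ((nat \<Rightarrow> 'v) \<Rightarrow> real)
    \<Rightarrow> (nat \<Rightarrow> 'v) \<Rightarrow> real" where
  "wedge k l \<alpha> \<beta> x =
     (\<Sum>\<sigma> \<in> {\<sigma>. \<sigma> permutes {..<k+l}}. of_int (sign \<sigma>) * \<alpha> (x \<circ> \<sigma>) * \<beta> (\<lambda>i. x (\<sigma> (i + k))))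
       / (fact k * fact l)"

definition contract :: "'v \<Rightarrow> ((nat \<Rightarrow> 'v) \<Rightarrow> real) \<Rightarrow> (nat \<Rightarrow> 'v) \<Rightarrow> real" where
  "contract v \<alpha> x = \<alpha> (\<lambda>i. if i = 0 then v else x (i - 1))"

definition sq3 :: "'v \<Rightarrow> 'v \<Rightarrow> 'v \<Rightarrow> nat \<Rightarrow> 'v" where
  "sq3 a b c = (\<lambda>i. if i = 0 then a else if i = 1 then b else c)"

text \<open>Chevalley--Eilenberg differential of a 3-form (d alpha (X,Y) = - alpha [X,Y] on 1-forms).\<close>

definition d3 :: "('v \<Rightarrow> 'v \<Rightarrow> 'v) \<Rightarrow> ((nat \<Rightarrow> 'v) \<Rightarrow> real) \<Rightarrow> (nat \<Rightarrow> 'v) \<Rightarrow> real" where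
  "d3 br \<phi> x =
     - \<phi> (sq3 (br (x 0) (x 1)) (x 2) (x 3)) + \<phi> (sq3 (br (x 0) (x 2)) (x 1) (x 3))
     - \<phi> (sq3 (br (x 0) (x 3)) (x 1) (x 2)) - \<phi> (sq3 (br (x 1) (x 2)) (x 0) (x 3))
     + \<phi> (sq3 (br (x 1) (x 3)) (x 0) (x 2)) - \<phi> (sq3 (br (x 2) (x 3)) (x 0) (x 1))"

definition calibrated :: "('v \<Rightarrow> 'v \<Rightarrow> 'v) \<Rightarrow> ((nat \<Rightarrow> 'v) \<Rightarrow> real) \<Rightarrow> bool" where
  "calibrated br \<phi> \<longleftrightarrow> (\<forall>x. d3 br \<phi> x = 0)"

text \<open>e^{ijk} on real^7 (coordinates indexed by the type 7; the index 7 is the element 7 = 0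
  of that type, distinct from 1..6).\<close>

definition e3 :: "7 \<Rightarrow> 7 \<Rightarrow> 7 \<Rightarrow> (nat \<Rightarrow> real^7) \<Rightarrow> real" where
  "e3 i j k x =
      x 0 $ i * (x 1 $ j * x 2 $ k - x 2 $ j * x 1 $ k)
    - x 0 $ j * (x 1 $ i * x 2 $ k - x 2 $ i * x 1 $ k)
    + x 0 $ k * (x 1 $ i * x 2 $ j - x 2 $ i * x 1 $ j)"

definition phi_eps :: "real \<Rightarrow> (nat \<Rightarrow> real^7) \<Rightarrow> real" where
  "phi_eps \<epsilon> x = - \<epsilon> * (e3 1 2 7 x + e3 3 4 7 x) + e3 5 6 7 x + e3 1 3 5 x
      - e3 1 4 6 x - e3 2 3 6 x - e3 2 4 5 x"

definition adapted_iso :: "real \<Rightarrow> ((nat \<Rightarrow> 'a::real_vector) \<Rightarrow> real) \<Rightarrow> ('a \<Rightarrow> real^7) \<Rightarrow> bool" where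
  "adapted_iso \<epsilon> \<phi> f \<longleftrightarrow> linear f \<and> bij f \<and> (\<forall>x. \<phi> x = phi_eps \<epsilon> (f \<circ> x))"

text \<open>G2^eps-structure: eps = -1 gives G2, eps = 1 gives G2^*.\<close>

definition G2_structure :: "real \<Rightarrow> ((nat \<Rightarrow> 'a::real_vector) \<Rightarrow> real) \<Rightarrow> bool" where
  "G2_structure \<epsilon> \<phi> \<longleftrightarrow> (\<exists>f. adapted_iso \<epsilon> \<phi> f)"

text \<open>g_phi(v,w) vol = 1/6 (v _| phi) ^ (w _| phi) ^ phi, where vol is the metric volume form
  for the orientation induced by phi (the one for which the adapted basis f^{-1}(e_1),...,f^{-1}(e_7)
  is positive); evaluated on that basis.\<close>

definition Bform :: "((nat \<Rightarrow> 'v) \<Rightarrow> real) \<Rightarrow> 'v \<Rightarrow> 'v \<Rightarrow> (nat \<Rightarrow> 'v) \<Rightarrow> real" where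
  "Bform \<phi> v w = (\<lambda>x. wedge 4 3 (wedge 2 2 (contract v \<phi>) (contract w \<phi>)) \<phi> x / 6)"

definition G2_metric :: "real \<Rightarrow> ((nat \<Rightarrow> 'a::real_vector) \<Rightarrow> real) \<Rightarrow> ('a \<Rightarrow> 'a \<Rightarrow> real) \<Rightarrow> bool" where
  "G2_metric \<epsilon> \<phi> g \<longleftrightarrow> (\<exists>f. adapted_iso \<epsilon> \<phi> f \<and>
     (let bb = (\<lambda>i::7. inv_into UNIV f (axis i 1)) in
      \<forall>v w. g v w * sqrt \<bar>Determinants.det (\<chi> i j. g (bb i) (bb j))\<bar>
            = Bform \<phi> v w (\<lambda>n. bb (of_nat (n + 1)))))"

definition pos_index :: "('a::real_vector \<Rightarrow> 'a \<Rightarrow> real) \<Rightarrow> 'a set \<Rightarrow> nat" where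
  "pos_index g U = Max {dim W | W. subspace W \<and> W \<subseteq> U \<and> (\<forall>w\<in>W. w \<noteq> 0 \<longrightarrow> g w w > 0)}"

definition neg_index :: "('a::real_vector \<Rightarrow> 'a \<Rightarrow> real) \<Rightarrow> 'a set \<Rightarrow> nat" where
  "neg_index g U = Max {dim W | W. subspace W \<and> W \<subseteq> U \<and> (\<forall>w\<in>W. w \<noteq> 0 \<longrightarrow> g w w < 0)}"

definition signature :: "('a::real_vector \<Rightarrow> 'a \<Rightarrow> real) \<Rightarrow> 'a set \<Rightarrow> nat \<times> nat" where
  "signature g U = (pos_index g U, neg_index g U)"

definition ordered_basis :: "nat \<Rightarrow> 'a::real_vector set \<Rightarrow> (nat \<Rightarrow> 'a) \<Rightarrow> bool" where
  "ordered_basis n U b \<longleftrightarrow> (\<forall>i<n. b i \<in> U) \<and> inj_on b {..<n} \<and>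
     independent (b ` {..<n}) \<and> span (b ` {..<n}) = U"

definition is_matrix_wrt :: "nat \<Rightarrow> (nat \<Rightarrow> 'a::real_vector) \<Rightarrow> ('a \<Rightarrow> 'a) \<Rightarrow> real mat \<Rightarrow> bool" where
  "is_matrix_wrt n b T M \<longleftrightarrow> M \<in> carrier_mat n n \<and>
     (\<forall>j<n. T (b j) = (\<Sum>i<n. M $$ (i, j) *\<^sub>R b i))"

definition mtrace :: "'a::comm_monoid_add mat \<Rightarrow> 'a" where
  "mtrace A = (\<Sum>i<dim_row A. A $$ (i, i))"

end

theory Submission
  imports Defs "Jordan_Normal_Form.Jordan_Normal_Form_Existence"
begin

text \<open>
  Let \<open>n\<close> be a normal vector of the hyperplane \<open>u\<close> for the metric of the structure; it is
  spacelike automatically for \<open>\<epsilon> = -1\<close>, and by the signature assumption for \<open>\<epsilon> = 1\<close>. The normalised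
  cross product with \<open>n\<close> is a complex structure \<open>J\<close> on \<open>u\<close>, for which the restriction of the three-form
  to \<open>u\<close> is the real part of a nonzero complex volume form. Closedness says that \<open>ad f7\<close> annihilates this
  restriction. This forces \<open>ad f7\<close> to commute with \<open>J\<close> and to have vanishing complex trace, which
  is the block form of (iii). Conversely, a complex trace-free endomorphism annihilates the real part of
  the complex determinant, and adding the terms in \<open>e\<^sup>7\<close> gives both calibrated structures. Over the
  complex numbers the block matrix is similar to \<open>diag (A + \<i> B, A - \<i> B)\<close>; since real matrices
  that are similar over the complex numbers are similar over the reals, (iii) and (iv) are equivalent.
\<close>

no_notation vec_index (infixl "$" 100)
hide_const (open) VectorSpace.subspace

section \<open>The model forms on real^7\<close>

text \<open>On the orthogonal complement of \<open>n\<close> the cross product with \<open>n\<close>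
  squares to \<open>- ip \<epsilon> n n\<close>, so a spacelike normal yields a complex structure,
  whereas a timelike one would yield a paracomplex structure. In passing from closedness to the
  block form no complex volume form is constructed: what is used is that \<open>J\<close> may be
  moved from one slot of the restricted form to another, which says that the form is of type
  (3,0)+(0,3), and that the form is nonzero on some triple. Both facts are proved for \<epsilon> = 1
  and \<epsilon> = -1 at once. The way back is uniform as well: closedness tests the form on
  \<open>u\<close> alone, and \<epsilon> occurs only in the monomials containing
  \<open>e\<^sup>7\<close>, so a single frame gives both structures. The costly part is the metric,
  which is defined through nested sums over permutations of up to seven arguments. Most of that sum
  collapses because the wedge of the two contractions is already alternating in four slots.\<close>

lemma exhaust_7:
  fixes x :: 7
  shows "x = 1 \<or> x = 2 \<or> x = 3 \<or> x = 4 \<or> x = 5 \<or> x = 6 \<or> x = 7"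
proof (induct x)
  case (of_int z)
  then have "0 \<le> z" and "z < 7" by simp_all
  then have "z = 0 \<or> z = 1 \<or> z = 2 \<or> z = 3 \<or> z = 4 \<or> z = 5 \<or> z = 6" by arith
  then show ?case by auto
qed

lemma UNIV_7: "UNIV = {1, 2, 3, 4, 5, 6, 7::7}"
  using exhaust_7 by auto

lemma forall_7: "(\<forall>i::7. P i) \<longleftrightarrow> P 1 \<and> P 2 \<and> P 3 \<and> P 4 \<and> P 5 \<and> P 6 \<and> P 7"
  by (metis exhaust_7)

lemma sum_7: "sum f (UNIV::7 set) = f 1 + f 2 + f 3 + f 4 + f 5 + f 6 + f 7"
  unfolding UNIV_7 by (simp add: add.assoc)

lemma vec7_eq_iff:
  fixes x y :: "real^7"
  shows "x = y \<longleftrightarrow> x$1 = y$1 \<and> x$2 = y$2 \<and> x$3 = y$3 \<and> x$4 = y$4 \<and> x$5 = y$5 \<and> x$6 = y$6 \<and> x$7 = y$7"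
  by (simp add: Finite_Cartesian_Product.vec_eq_iff forall_7)

definition tri :: "real \<Rightarrow> real^7 \<Rightarrow> real^7 \<Rightarrow> real^7 \<Rightarrow> real" where
  "tri \<epsilon> x y z = phi_eps \<epsilon> (sq3 x y z)"

text \<open>The metric induced by the model form: positive definite for \<epsilon> = -1 and of
  signature (3,4) for \<epsilon> = 1.\<close>

definition ip :: "real \<Rightarrow> real^7 \<Rightarrow> real^7 \<Rightarrow> real" where
  "ip \<epsilon> x y = - \<epsilon> * (x$1 * y$1 + x$2 * y$2 + x$3 * y$3 + x$4 * y$4) + x$5 * y$5 + x$6 * y$6 + x$7 * y$7"

text \<open>The last slot of \<open>tri\<close> is raised with \<open>ip\<close>; for \<epsilon> = 1
  and \<epsilon> = -1 the factor \<open>- \<epsilon>\<close> is its own inverse, so the Gram matrix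
  of \<open>ip\<close> also serves as the inverse metric.\<close>

definition cross7 :: "real \<Rightarrow> real^7 \<Rightarrow> real^7 \<Rightarrow> real^7" where
  "cross7 \<epsilon> x y = (\<chi> i. (if i \<in> {1, 2, 3, 4} then - \<epsilon> else 1) * tri \<epsilon> x y (axis i 1))"

lemma phi_eps_eq_tri: "phi_eps \<epsilon> x = tri \<epsilon> (x 0) (x 1) (x 2)"
  by (simp add: tri_def phi_eps_def e3_def sq3_def)

lemma tri_expand: "tri \<epsilon> x y z =
    - \<epsilon> * ((x$1 * (y$2 * z$7 - z$2 * y$7) - x$2 * (y$1 * z$7 - z$1 * y$7) + x$7 * (y$1 * z$2 - z$1 * y$2))
      + (x$3 * (y$4 * z$7 - z$4 * y$7) - x$4 * (y$3 * z$7 - z$3 * y$7) + x$7 * (y$3 * z$4 - z$3 * y$4)))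
    + (x$5 * (y$6 * z$7 - z$6 * y$7) - x$6 * (y$5 * z$7 - z$5 * y$7) + x$7 * (y$5 * z$6 - z$5 * y$6))
    + (x$1 * (y$3 * z$5 - z$3 * y$5) - x$3 * (y$1 * z$5 - z$1 * y$5) + x$5 * (y$1 * z$3 - z$1 * y$3))
    - (x$1 * (y$4 * z$6 - z$4 * y$6) - x$4 * (y$1 * z$6 - z$1 * y$6) + x$6 * (y$1 * z$4 - z$1 * y$4))
    - (x$2 * (y$3 * z$6 - z$3 * y$6) - x$3 * (y$2 * z$6 - z$2 * y$6) + x$6 * (y$2 * z$3 - z$2 * y$3))
    - (x$2 * (y$4 * z$5 - z$4 * y$5) - x$4 * (y$2 * z$5 - z$2 * y$5) + x$5 * (y$2 * z$4 - z$2 * y$4))"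
  by (simp add: tri_def phi_eps_def e3_def sq3_def)

lemma tri_swap12: "tri \<epsilon> y x z = - tri \<epsilon> x y z"
  unfolding tri_expand by (simp add: algebra_simps)

lemma tri_swap23: "tri \<epsilon> x z y = - tri \<epsilon> x y z"
  unfolding tri_expand by (simp add: algebra_simps)

lemma tri_add1: "tri \<epsilon> (x + x') y z = tri \<epsilon> x y z + tri \<epsilon> x' y z"
  unfolding tri_expand by (simp add: algebra_simps)

lemma tri_scale1: "tri \<epsilon> (c *\<^sub>R x) y z = c * tri \<epsilon> x y z"
  unfolding tri_expand by (simp add: algebra_simps)

lemma tri_rot: "tri \<epsilon> x y z = tri \<epsilon> y z x"
  unfolding tri_swap12[of \<epsilon> x y] tri_swap23[of \<epsilon> y x z] by simp

lemma linear_ip: "linear (ip \<epsilon> x)"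
  by (rule linearI) (simp_all add: ip_def algebra_simps)

lemma ip_commute: "ip \<epsilon> x y = ip \<epsilon> y x"
  by (simp add: ip_def mult.commute)

lemma linear_cross7: "linear (cross7 \<epsilon> x)"
proof (rule linearI)
  show "cross7 \<epsilon> x (y + z) = cross7 \<epsilon> x y + cross7 \<epsilon> x z" for y z
    by (simp add: cross7_def Finite_Cartesian_Product.vec_eq_iff tri_rot[of \<epsilon> x] tri_add1 algebra_simps)
  show "cross7 \<epsilon> x (c *\<^sub>R y) = c *\<^sub>R cross7 \<epsilon> x y" for c y
    by (simp add: cross7_def Finite_Cartesian_Product.vec_eq_iff tri_rot[of \<epsilon> x] tri_scale1 algebra_simps)
qed

lemma axis_7 [simp]:
  "axis (i::7) (1::real) $ j = (if j = i then 1 else 0)"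
  by (auto simp: axis_def)

lemma cross7_components:
  assumes "\<epsilon> = 1 \<or> \<epsilon> = -1"
  shows
  "cross7 \<epsilon> x y $ 1 = (x$2 * y$7 - x$7 * y$2) - \<epsilon> * (x$3 * y$5 - x$5 * y$3) + \<epsilon> * (x$4 * y$6 - x$6 * y$4)"
  "cross7 \<epsilon> x y $ 2 = (x$7 * y$1 - x$1 * y$7) + \<epsilon> * (x$3 * y$6 - x$6 * y$3) + \<epsilon> * (x$4 * y$5 - x$5 * y$4)"
  "cross7 \<epsilon> x y $ 3 = (x$4 * y$7 - x$7 * y$4) - \<epsilon> * (x$5 * y$1 - x$1 * y$5) + \<epsilon> * (x$6 * y$2 - x$2 * y$6)"
  "cross7 \<epsilon> x y $ 4 = (x$7 * y$3 - x$3 * y$7) + \<epsilon> * (x$6 * y$1 - x$1 * y$6) + \<epsilon> * (x$5 * y$2 - x$2 * y$5)"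
  "cross7 \<epsilon> x y $ 5 = (x$6 * y$7 - x$7 * y$6) + (x$1 * y$3 - x$3 * y$1) + (x$4 * y$2 - x$2 * y$4)"
  "cross7 \<epsilon> x y $ 6 = (x$7 * y$5 - x$5 * y$7) + (x$4 * y$1 - x$1 * y$4) + (x$3 * y$2 - x$2 * y$3)"
  "cross7 \<epsilon> x y $ 7 = - \<epsilon> * (x$1 * y$2 - x$2 * y$1) - \<epsilon> * (x$3 * y$4 - x$4 * y$3) + (x$5 * y$6 - x$6 * y$5)"
  using assms by (auto simp: cross7_def tri_expand algebra_simps)

lemma ip_cross7: "\<epsilon> = 1 \<or> \<epsilon> = -1 \<Longrightarrow> ip \<epsilon> (cross7 \<epsilon> x y) z = tri \<epsilon> x y z"
  by (auto simp: ip_def cross7_components tri_expand algebra_simps)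

lemma cross7_cross7:
  assumes "\<epsilon> = 1 \<or> \<epsilon> = -1"
  shows "cross7 \<epsilon> x (cross7 \<epsilon> x y) = ip \<epsilon> x y *\<^sub>R x - ip \<epsilon> x x *\<^sub>R y"
  using assms
  by (elim disjE) (simp_all add: vec7_eq_iff ip_def cross7_components algebra_simps)

text \<open>By antisymmetry the left side is y x (z x n) + z x (y x n), so this is the polarisation
  of \<open>cross7_cross7\<close> in its repeated argument.\<close>

lemma cross7_swap:
  assumes "\<epsilon> = 1 \<or> \<epsilon> = -1"
  shows "cross7 \<epsilon> (cross7 \<epsilon> n y) z - cross7 \<epsilon> y (cross7 \<epsilon> n z)
    = ip \<epsilon> z n *\<^sub>R y + ip \<epsilon> y n *\<^sub>R z - (2 * ip \<epsilon> z y) *\<^sub>R n"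
  unfolding vec7_eq_iff using assms
  by (elim disjE; intro conjI) (simp_all add: ip_def cross7_components algebra_simps)

text \<open>The defect given by \<open>cross7_swap\<close> has components along \<open>y\<close>,
  \<open>z\<close> and \<open>n\<close>. Those along \<open>y\<close> and \<open>z\<close> have
  coefficient zero because both vectors are orthogonal to \<open>n\<close>; the one along
  \<open>n\<close> disappears after pairing with \<open>w\<close>. This is the mobility of
  \<open>J\<close> between the slots.\<close>

lemma tri_cross7_swap:
  assumes e: "\<epsilon> = 1 \<or> \<epsilon> = -1" and "ip \<epsilon> n y = 0" "ip \<epsilon> n z = 0" "ip \<epsilon> n w = 0"
  shows "tri \<epsilon> (cross7 \<epsilon> n y) z w = tri \<epsilon> y (cross7 \<epsilon> n z) w"
proof -
  have "tri \<epsilon> (cross7 \<epsilon> n y) z w - tri \<epsilon> y (cross7 \<epsilon> n z) w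
      = ip \<epsilon> w (cross7 \<epsilon> (cross7 \<epsilon> n y) z - cross7 \<epsilon> y (cross7 \<epsilon> n z))"
    by (simp add: ip_cross7[OF e, symmetric] linear_diff[OF linear_ip] ip_commute)
  also have "\<dots> = 0"
    using assms
    by (simp add: cross7_swap[OF e] linear_diff[OF linear_ip] linear_add[OF linear_ip]
        linear_scale[OF linear_ip] linear_neg[OF linear_ip] ip_commute[of _ _ n])
  finally show ?thesis by simp
qed

lemma tri_scaleR3: "tri \<epsilon> (a *\<^sub>R x) (b *\<^sub>R y) (c *\<^sub>R z) = a * b * c * tri \<epsilon> x y z"
  unfolding tri_expand by (simp add: algebra_simps)

text \<open>Otherwise inserting the projections of the basis vectors along \<open>n\<close> and summing over the
  seven monomials of the form, each index occurring in three of them, gives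
  \<open>7 ip n n = 3 ip n n\<close>.\<close>

lemma tri_nonzero_on_hyperplane:
  assumes e: "\<epsilon> = 1 \<or> \<epsilon> = -1" and n: "ip \<epsilon> n n \<noteq> 0"
  shows "\<exists>x y z. ip \<epsilon> n x = 0 \<and> ip \<epsilon> n y = 0 \<and> ip \<epsilon> n z = 0 \<and> tri \<epsilon> x y z \<noteq> 0"
proof (rule ccontr)
  assume "\<not> ?thesis"
  then have zero: "tri \<epsilon> x y z = 0" if "ip \<epsilon> n x = 0" "ip \<epsilon> n y = 0" "ip \<epsilon> n z = 0" for x y z
    using that by blast
  define N where "N = ip \<epsilon> n n"
  define p where "p x = x - (ip \<epsilon> n x / N) *\<^sub>R n" for x
  have ipp: "ip \<epsilon> n (p x) = 0" for x
    using n by (simp add: p_def N_def linear_diff[OF linear_ip] linear_scale[OF linear_ip])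
  have s1: "tri \<epsilon> (x - a *\<^sub>R n) y z = tri \<epsilon> x y z - a * tri \<epsilon> n y z" for x y z a
    using tri_add1[of \<epsilon> x "(-a) *\<^sub>R n" y z] tri_scale1[of \<epsilon> "-a" n y z] by simp
  have s2: "tri \<epsilon> x (y - a *\<^sub>R n) z = tri \<epsilon> x y z - a * tri \<epsilon> x n z" for x y z a
    using s1[of y a x z] tri_swap12[of \<epsilon> x y z] tri_swap12[of \<epsilon> x n z]
      tri_swap12[of \<epsilon> x "y - a *\<^sub>R n" z] by (simp add: algebra_simps)
  have s3: "tri \<epsilon> x y (z - a *\<^sub>R n) = tri \<epsilon> x y z - a * tri \<epsilon> x y n" for x y z a
    using s1[of z a x y] tri_rot[of \<epsilon> z x y] tri_rot[of \<epsilon> n x y] tri_rot[of \<epsilon> "z - a *\<^sub>R n" x y]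
    by simp
  have nn: "tri \<epsilon> n n z = 0" "tri \<epsilon> z n n = 0" "tri \<epsilon> n z n = 0" for z
    using tri_swap12[of \<epsilon> n n z] tri_swap23[of \<epsilon> z n n] tri_swap23[of \<epsilon> n z n] by auto
  \<comment> \<open>If the form vanishes on the hyperplane, it is recovered from its contraction
    with \<open>n\<close>: up to the factor \<open>N\<close> it is the wedge of the covector
    \<open>ip \<epsilon> n\<close> with that contraction.\<close>
  have expand: "N * tri \<epsilon> x y z
      = ip \<epsilon> n x * tri \<epsilon> n y z + ip \<epsilon> n y * tri \<epsilon> x n z + ip \<epsilon> n z * tri \<epsilon> x y n" for x y z
  proof -
    have "0 = tri \<epsilon> (p x) (p y) (p z)"
      using zero ipp by simp
    also have "\<dots> = tri \<epsilon> x y z - ip \<epsilon> n x / N * tri \<epsilon> n y z - ip \<epsilon> n y / N * tri \<epsilon> x n z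
        - ip \<epsilon> n z / N * tri \<epsilon> x y n"
      unfolding p_def s1 s2 s3 nn by (simp add: algebra_simps)
    finally have "tri \<epsilon> x y z = ip \<epsilon> n x / N * tri \<epsilon> n y z + ip \<epsilon> n y / N * tri \<epsilon> x n z
        + ip \<epsilon> n z / N * tri \<epsilon> x y n"
      by linarith
    then show ?thesis using n unfolding N_def[symmetric] by (simp add: distrib_left)
  qed
  let ?e = "\<lambda>i::7. axis i (1::real)"
  have "(- \<epsilon>) * (N * tri \<epsilon> (?e 1) (?e 2) (?e 7)) + (- \<epsilon>) * (N * tri \<epsilon> (?e 3) (?e 4) (?e 7))
      + N * tri \<epsilon> (?e 5) (?e 6) (?e 7) + N * tri \<epsilon> (?e 1) (?e 3) (?e 5)
      - N * tri \<epsilon> (?e 1) (?e 4) (?e 6) - N * tri \<epsilon> (?e 2) (?e 3) (?e 6)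
      - N * tri \<epsilon> (?e 2) (?e 4) (?e 5) = 3 * N"
    unfolding expand using e
    by (elim disjE) (simp_all add: tri_expand ip_def N_def algebra_simps)
  moreover have "\<epsilon> * \<epsilon> = 1" using e by auto
  then have "(- \<epsilon>) * (N * tri \<epsilon> (?e 1) (?e 2) (?e 7)) + (- \<epsilon>) * (N * tri \<epsilon> (?e 3) (?e 4) (?e 7))
      + N * tri \<epsilon> (?e 5) (?e 6) (?e 7) + N * tri \<epsilon> (?e 1) (?e 3) (?e 5)
      - N * tri \<epsilon> (?e 1) (?e 4) (?e 6) - N * tri \<epsilon> (?e 2) (?e 3) (?e 6)
      - N * tri \<epsilon> (?e 2) (?e 4) (?e 5) = 7 * N"
    by (simp add: tri_expand)
  ultimately show False using n N_def by simp
qed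

section \<open>The metric of a G2*-structure\<close>

definition alternation :: "nat \<Rightarrow> ((nat \<Rightarrow> 'v) \<Rightarrow> real) \<Rightarrow> (nat \<Rightarrow> 'v) \<Rightarrow> real" where
  "alternation n F x = (\<Sum>\<sigma> | \<sigma> permutes {..<n}. of_int (sign \<sigma>) * F (x \<circ> \<sigma>))"

lemma alternation_0: "alternation 0 F x = F x"
  by (simp add: alternation_def)

text \<open>Every permutation of \<open>{..<Suc n}\<close> is uniquely a transposition of
  \<open>n\<close> with some \<open>b \<le> n\<close> followed on the inside by a permutation of
  \<open>{..<n}\<close>. The sum can thus be unfolded one slot at a time, and unfolding can stop
  early.\<close>

lemma alternation_Suc:
  "alternation (Suc n) F x =
    alternation n F x - (\<Sum>b<n. alternation n F (x \<circ> Transposition.transpose n b))"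
proof -
  have sg: "sign (Transposition.transpose n b \<circ> q) = (if n = b then 1 else -1) * sign q"
    if "q permutes {..<n}" for b q
  proof -
    have "permutation q" using that by (meson finite_lessThan permutation_permutes)
    then show ?thesis by (simp add: sign_compose sign_swap_id permutation_swap_id)
  qed
  have "alternation (Suc n) F x = (\<Sum>b\<in>insert n {..<n}. \<Sum>q | q permutes {..<n}.
      of_int (sign (Transposition.transpose n b \<circ> q)) * F (x \<circ> (Transposition.transpose n b \<circ> q)))"
    unfolding alternation_def lessThan_Suc by (rule sum_over_permutations_insert) auto
  also have "\<dots> = (\<Sum>b\<in>insert n {..<n}. (if n = b then 1 else -1) * alternation n F (x \<circ> Transposition.transpose n b))"
    unfolding alternation_def sum_distrib_left
    by (intro sum.cong refl) (simp add: sg comp_assoc)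
  also have "\<dots> = alternation n F x + (\<Sum>b<n. - alternation n F (x \<circ> Transposition.transpose n b))"
    by (subst sum.insert) (auto intro!: arg_cong2[where f = plus] sum.cong)
  finally show ?thesis by (simp add: sum_negf)
qed

lemma alternation_comp:
  assumes "\<tau> permutes {..<n}"
  shows "alternation n F (x \<circ> \<tau>) = of_int (sign \<tau>) * alternation n F x"
proof -
  have t: "permutation \<tau>" using assms by (meson finite_lessThan permutation_permutes)
  have "alternation n F x = (\<Sum>\<sigma> | \<sigma> permutes {..<n}. of_int (sign (\<tau> \<circ> \<sigma>)) * F (x \<circ> (\<tau> \<circ> \<sigma>)))"
    unfolding alternation_def by (rule setum_permutations_compose_left[OF assms])
  also have "\<dots> = of_int (sign \<tau>) * alternation n F (x \<circ> \<tau>)"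
    unfolding alternation_def sum_distrib_left
  proof (intro sum.cong refl)
    fix \<sigma> assume "\<sigma> \<in> {\<sigma>. \<sigma> permutes {..<n}}"
    then have "permutation \<sigma>" by (metis finite_lessThan mem_Collect_eq permutation_permutes)
    then show "of_int (sign (\<tau> \<circ> \<sigma>)) * F (x \<circ> (\<tau> \<circ> \<sigma>))
        = of_int (sign \<tau>) * (of_int (sign \<sigma>) * F (x \<circ> \<tau> \<circ> \<sigma>))"
      using t by (simp add: sign_compose comp_assoc)
  qed
  finally have "of_int (sign \<tau>) * alternation n F x
      = of_int (sign \<tau> * sign \<tau>) * alternation n F (x \<circ> \<tau>)"
    by (simp only: of_int_mult mult.assoc)
  then show ?thesis by simp
qed

text \<open>The two signs cancel, so all summands agree. This removes the permutations of slots in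
  which the integrand is already alternating.\<close>

lemma alternation_mult:
  assumes "\<And>y \<sigma>. \<sigma> permutes {..<n} \<Longrightarrow> G (y \<circ> \<sigma>) = of_int (sign \<sigma>) * G y"
    and "\<And>y \<sigma>. \<sigma> permutes {..<n} \<Longrightarrow> H (y \<circ> \<sigma>) = H y"
  shows "alternation n (\<lambda>y. G y * H y) x = fact n * (G x * H x)"
proof -
  have "of_int (sign \<sigma>) * (of_int (sign \<sigma>) * G x * H x) = G x * H x" for \<sigma> :: "nat \<Rightarrow> nat"
    by (simp add: sign_def)
  then have "alternation n (\<lambda>y. G y * H y) x = (\<Sum>\<sigma> | \<sigma> permutes {..<n}. G x * H x)"
    unfolding alternation_def using assms by (intro sum.cong) auto
  then show ?thesis by (simp add: card_permutations[OF refl])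
qed

lemma wedge_alternation:
  "wedge k l \<alpha> \<beta> x = alternation (k + l) (\<lambda>y. \<alpha> y * \<beta> (\<lambda>i. y (i + k))) x / (fact k * fact l)"
  by (simp add: wedge_def alternation_def mult.assoc comp_def)

text \<open>The 24 permutations fall into six (2,2)-shuffles of four equal terms each, and the four
  cancels against \<open>fact 2 * fact 2\<close>.\<close>

lemma wedge_2_2:
  assumes "\<And>y. \<alpha> y = a (y 0) (y 1)" "\<And>y. \<beta> y = b (y 0) (y 1)"
    and "\<And>p q. a p q = - a q p" "\<And>p q. b p q = - b q p"
  shows "wedge 2 2 \<alpha> \<beta> y =
    a (y 0) (y 1) * b (y 2) (y 3) - a (y 0) (y 2) * b (y 1) (y 3) + a (y 0) (y 3) * b (y 1) (y 2)
    + a (y 1) (y 2) * b (y 0) (y 3) - a (y 1) (y 3) * b (y 0) (y 2) + a (y 2) (y 3) * b (y 0) (y 1)"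
proof -
  have a: "a (y 1) (y 0) = - a (y 0) (y 1)" "a (y 2) (y 0) = - a (y 0) (y 2)" "a (y 3) (y 0) = - a (y 0) (y 3)"
    "a (y 2) (y 1) = - a (y 1) (y 2)" "a (y 3) (y 1) = - a (y 1) (y 3)" "a (y 3) (y 2) = - a (y 2) (y 3)"
    and b: "b (y 1) (y 0) = - b (y 0) (y 1)" "b (y 2) (y 0) = - b (y 0) (y 2)" "b (y 3) (y 0) = - b (y 0) (y 3)"
    "b (y 2) (y 1) = - b (y 1) (y 2)" "b (y 3) (y 1) = - b (y 1) (y 3)" "b (y 3) (y 2) = - b (y 2) (y 3)"
    by (rule assms(3) assms(4))+
  have 4: "2 + 2 = Suc (Suc (Suc (Suc 0)))" by simp
  show ?thesis
    unfolding wedge_alternation 4 alternation_Suc alternation_0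
    using a b
    by (simp add: assms(1,2) Transposition.transpose_def numeral_2_eq_2 numeral_3_eq_3 field_simps)
qed

text \<open>The contraction of the form with \<open>v\<close> tabulated on pairs of basis vectors,
  so that the long sum for the metric is simplified by rewriting with table entries instead of by
  expanding the form.\<close>

lemma tri_axis:
  "tri 1 v (axis 1 1) (axis 1 1) = 0" "tri 1 v (axis 1 1) (axis 2 1) = - v$7"
  "tri 1 v (axis 1 1) (axis 3 1) = v$5" "tri 1 v (axis 1 1) (axis 4 1) = - v$6"
  "tri 1 v (axis 1 1) (axis 5 1) = - v$3" "tri 1 v (axis 1 1) (axis 6 1) = v$4"
  "tri 1 v (axis 1 1) (axis 7 1) = v$2"
  "tri 1 v (axis 2 1) (axis 1 1) = v$7" "tri 1 v (axis 2 1) (axis 2 1) = 0"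
  "tri 1 v (axis 2 1) (axis 3 1) = - v$6" "tri 1 v (axis 2 1) (axis 4 1) = - v$5"
  "tri 1 v (axis 2 1) (axis 5 1) = v$4" "tri 1 v (axis 2 1) (axis 6 1) = v$3"
  "tri 1 v (axis 2 1) (axis 7 1) = - v$1"
  "tri 1 v (axis 3 1) (axis 1 1) = - v$5" "tri 1 v (axis 3 1) (axis 2 1) = v$6"
  "tri 1 v (axis 3 1) (axis 3 1) = 0" "tri 1 v (axis 3 1) (axis 4 1) = - v$7"
  "tri 1 v (axis 3 1) (axis 5 1) = v$1" "tri 1 v (axis 3 1) (axis 6 1) = - v$2"
  "tri 1 v (axis 3 1) (axis 7 1) = v$4"
  "tri 1 v (axis 4 1) (axis 1 1) = v$6" "tri 1 v (axis 4 1) (axis 2 1) = v$5"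
  "tri 1 v (axis 4 1) (axis 3 1) = v$7" "tri 1 v (axis 4 1) (axis 4 1) = 0"
  "tri 1 v (axis 4 1) (axis 5 1) = - v$2" "tri 1 v (axis 4 1) (axis 6 1) = - v$1"
  "tri 1 v (axis 4 1) (axis 7 1) = - v$3"
  "tri 1 v (axis 5 1) (axis 1 1) = v$3" "tri 1 v (axis 5 1) (axis 2 1) = - v$4"
  "tri 1 v (axis 5 1) (axis 3 1) = - v$1" "tri 1 v (axis 5 1) (axis 4 1) = v$2"
  "tri 1 v (axis 5 1) (axis 5 1) = 0" "tri 1 v (axis 5 1) (axis 6 1) = v$7"
  "tri 1 v (axis 5 1) (axis 7 1) = - v$6"
  "tri 1 v (axis 6 1) (axis 1 1) = - v$4" "tri 1 v (axis 6 1) (axis 2 1) = - v$3"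
  "tri 1 v (axis 6 1) (axis 3 1) = v$2" "tri 1 v (axis 6 1) (axis 4 1) = v$1"
  "tri 1 v (axis 6 1) (axis 5 1) = - v$7" "tri 1 v (axis 6 1) (axis 6 1) = 0"
  "tri 1 v (axis 6 1) (axis 7 1) = v$5"
  "tri 1 v (axis 7 1) (axis 1 1) = - v$2" "tri 1 v (axis 7 1) (axis 2 1) = v$1"
  "tri 1 v (axis 7 1) (axis 3 1) = - v$4" "tri 1 v (axis 7 1) (axis 4 1) = v$3"
  "tri 1 v (axis 7 1) (axis 5 1) = v$6" "tri 1 v (axis 7 1) (axis 6 1) = - v$5"
  "tri 1 v (axis 7 1) (axis 7 1) = 0"
  by (simp_all add: tri_expand)

lemma alternating_wedge:
  "\<sigma> permutes {..<k + l} \<Longrightarrow> wedge k l \<alpha> \<beta> (x \<circ> \<sigma>) = of_int (sign \<sigma>) * wedge k l \<alpha> \<beta> x"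
  by (simp add: wedge_alternation alternation_comp)

text \<open>Statement (ii) is the one that mentions the metric, so the computation is made for
  \<epsilon> = 1. The volume form takes the value 1 on the standard basis, hence the right side
  carries no factor.\<close>

lemma Bform_phi_eps: "Bform (phi_eps 1) v w (\<lambda>n. axis (of_nat (n + 1)) 1) = ip 1 v w"
proof -
  define \<gamma> where "\<gamma> = wedge 2 2 (contract v (phi_eps 1)) (contract w (phi_eps 1))"
  define F where "F y = \<gamma> y * tri 1 (y 4) (y 5) (y 6)" for y :: "nat \<Rightarrow> real^7"
  define E :: "nat \<Rightarrow> real^7" where "E n = axis (of_nat (n + 1)) 1" for n
  have c: "contract v (phi_eps 1) y = tri 1 v (y 0) (y 1)" for v y
    by (simp add: contract_def phi_eps_eq_tri)
  have \<gamma>: "\<gamma> y = tri 1 v (y 0) (y 1) * tri 1 w (y 2) (y 3) - tri 1 v (y 0) (y 2) * tri 1 w (y 1) (y 3)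
    + tri 1 v (y 0) (y 3) * tri 1 w (y 1) (y 2) + tri 1 v (y 1) (y 2) * tri 1 w (y 0) (y 3)
    - tri 1 v (y 1) (y 3) * tri 1 w (y 0) (y 2) + tri 1 v (y 2) (y 3) * tri 1 w (y 0) (y 1)" for y
    unfolding \<gamma>_def by (rule wedge_2_2[OF c c tri_swap23 tri_swap23])
  \<comment> \<open>\<open>\<gamma>\<close> is alternating in slots 0 to 3 and the other factor does
    not see them. After this, three uses of \<open>alternation_Suc\<close> leave 7 * 6 * 5 = 210
    values of \<open>F\<close>.\<close>
  have alt4: "alternation 4 F y = 24 * F y" for y
  proof -
    have "alternation 4 F y = fact 4 * F y"
      unfolding F_def
    proof (rule alternation_mult)
      show "\<gamma> (y \<circ> \<sigma>) = of_int (sign \<sigma>) * \<gamma> y" if "\<sigma> permutes {..<4}" for y \<sigma>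
        using that alternating_wedge[of \<sigma> 2 2] by (simp add: \<gamma>_def)
      show "tri 1 ((y \<circ> \<sigma>) 4) ((y \<circ> \<sigma>) 5) ((y \<circ> \<sigma>) 6) = tri 1 (y 4) (y 5) (y 6)"
        if "\<sigma> permutes {..<4}" for y :: "nat \<Rightarrow> real^7" and \<sigma>
        using permutes_not_in[OF that] by simp
    qed
    then show ?thesis by (simp add: fact_numeral)
  qed
  \<comment> \<open>864 = 4! * 3! * 6: the normalisation of the wedge of a 4-form with a 3-form, and
    the factor 1/6 in the definition of the metric.\<close>
  have "Bform (phi_eps 1) v w E = alternation 7 F E / 864"
    by (simp add: Bform_def wedge_alternation[of 4 3] \<gamma>_def[symmetric] phi_eps_eq_tri F_def[abs_def]
        fact_numeral)
  also have "alternation 7 F E = alternation (Suc (Suc (Suc 4))) F E"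
    by simp
  also have "\<dots> = 864 * ip 1 v w"
  proof -
    have S: "sum f {..<4} = f 0 + f 1 + f 2 + f 3" "sum f {..<5} = f 0 + f 1 + f 2 + f 3 + f 4"
      "sum f {..<6} = f 0 + f 1 + f 2 + f 3 + f 4 + f 5" for f :: "nat \<Rightarrow> real"
      by (simp_all add: lessThan_Suc numeral_eq_Suc add_ac)
    have E: "E 0 = axis 1 1" "E 1 = axis 2 1" "E 2 = axis 3 1" "E 3 = axis 4 1" "E 4 = axis 5 1"
      "E 5 = axis 6 1" "E 6 = axis 7 1"
      by (simp_all add: E_def)
    note [simp] = tri_axis
    show ?thesis
      unfolding alternation_Suc alt4
      by (simp add: S F_def \<gamma> Transposition.transpose_def E ip_def del: One_nat_def)
  qed
  finally show ?thesis by (simp add: E_def[abs_def])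
qed

section \<open>Transport of the model metric along an adapted isomorphism\<close>

lemma wedge_pullback:
  "wedge k l (\<lambda>x. \<alpha> (f \<circ> x)) (\<lambda>x. \<beta> (f \<circ> x)) = (\<lambda>x. wedge k l \<alpha> \<beta> (f \<circ> x))"
  by (intro ext) (simp add: wedge_def comp_def)

lemma contract_pullback: "contract v (\<lambda>x. \<alpha> (f \<circ> x)) = (\<lambda>x. contract (f v) \<alpha> (f \<circ> x))"
  unfolding contract_def by (intro ext arg_cong[where f = \<alpha>]) auto

lemma Bform_pullback: "Bform (\<lambda>x. \<phi> (f \<circ> x)) v w x = Bform \<phi> (f v) (f w) (f \<circ> x)"
  unfolding Bform_def contract_pullback[of _ \<phi>]
    wedge_pullback[of 2 2 "contract (f v) \<phi>" f "contract (f w) \<phi>"]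
    wedge_pullback[of 4 3 "wedge 2 2 (contract (f v) \<phi>) (contract (f w) \<phi>)" f \<phi>] ..

lemma Bform_adapted_iso:
  assumes "adapted_iso 1 \<phi> f"
  shows "Bform \<phi> v w (\<lambda>n. inv_into UNIV f (axis (of_nat (n + 1)) 1)) = ip 1 (f v) (f w)"
proof -
  have \<phi>: "\<phi> = (\<lambda>x. phi_eps 1 (f \<circ> x))" and "surj f"
    using assms by (auto simp: adapted_iso_def bij_is_surj)
  have "f \<circ> (\<lambda>n. inv_into UNIV f (axis (of_nat (n + 1)) 1)) = (\<lambda>n. axis (of_nat (n + 1)) 1)"
    using \<open>surj f\<close> by (simp add: fun_eq_iff surj_f_inv_f)
  then show ?thesis
    unfolding \<phi> Bform_pullback[of "phi_eps 1" f] by (simp only: Bform_phi_eps)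
qed

lemma ip_axis: "ip 1 (axis i 1) y = (if i \<in> {1, 2, 3, 4} then -1 else 1) * y$i"
proof -
  have "\<forall>i. ip 1 (axis i 1) y = (if i \<in> {1, 2, 3, 4} then -1 else 1) * y$i"
    unfolding forall_7 by (simp add: ip_def)
  then show ?thesis by blast
qed

text \<open>The defining equation is implicit, since \<open>g\<close> also enters the determinant.
  The scale \<open>s\<close> is left undetermined: a positive factor does not affect the sign of
  \<open>g w w\<close>, and that sign is what the signature argument reads off.\<close>

lemma G2_metricD:
  assumes "G2_metric 1 \<phi> g"
  obtains f s where "adapted_iso 1 \<phi> f" "s > 0" "\<And>v w. g v w * s = ip 1 (f v) (f w)"
proof -
  obtain f where f: "adapted_iso 1 \<phi> f"
    and g: "\<forall>v w. g v w * sqrt \<bar>Determinants.det (\<chi> i j. g (inv_into UNIV f (axis i 1)) (inv_into UNIV f (axis j 1)))\<bar>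
            = Bform \<phi> v w (\<lambda>n. inv_into UNIV f (axis (of_nat (n + 1)) 1))"
    using assms unfolding G2_metric_def Let_def by blast
  define s where "s = sqrt \<bar>Determinants.det (\<chi> i j. g (inv_into UNIV f (axis i 1)) (inv_into UNIV f (axis j 1)))\<bar>"
  have gs: "g v w * s = ip 1 (f v) (f w)" for v w
    using g unfolding s_def[symmetric] Bform_adapted_iso[OF f] by blast
  have "f (inv_into UNIV f (axis 7 1)) = axis 7 1"
    using f by (simp add: adapted_iso_def bij_is_surj surj_f_inv_f)
  \<comment> \<open>On the seventh adapted basis vector the right side of the defining equation is
    1.\<close>
  then have "s \<noteq> 0"
    using gs[of "inv_into UNIV f (axis 7 1)" "inv_into UNIV f (axis 7 1)"] by (auto simp: ip_axis)
  moreover have "s \<ge> 0" by (simp add: s_def)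
  ultimately show ?thesis using that[OF f _ gs] by simp
qed

text \<open>The Gram matrix of an adapted basis is diagonal with four entries -1 and three entries
  1, so its determinant is 1 and the implicit equation reduces to
  \<open>Bform_adapted_iso\<close>.\<close>

lemma G2_metric_ip:
  assumes "adapted_iso 1 \<phi> f"
  shows "G2_metric 1 \<phi> (\<lambda>v w. ip 1 (f v) (f w))"
proof -
  have f: "f (inv_into UNIV f x) = x" for x
    using assms by (simp add: adapted_iso_def bij_is_surj surj_f_inv_f)
  let ?D = "(\<chi> i j. ip 1 (axis i 1) (axis j 1)) :: real^7^7"
  have "Determinants.det ?D = (\<Prod>i\<in>UNIV. ?D $ i $ i)"
    by (rule det_diagonal) (simp add: ip_axis)
  also have "\<dots> = (\<Prod>i\<in>UNIV. if i \<in> {1, 2, 3, 4::7} then -1 else 1)"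
    by (intro prod.cong) (simp_all add: ip_axis)
  also have "\<dots> = 1"
    unfolding UNIV_7 by simp
  finally have "g * sqrt \<bar>Determinants.det ?D\<bar> = g" for g
    by simp
  then show ?thesis
    unfolding G2_metric_def Let_def f using assms Bform_adapted_iso[OF assms]
    by (intro exI[of _ f] conjI allI) (simp_all only: f)
qed

section \<open>Ordered bases\<close>

lemma ordered_basisI:
  fixes u :: "'a::euclidean_space set"
  assumes u: "subspace u" "dim u = n" and b: "\<And>i. i < n \<Longrightarrow> b i \<in> u"
    and ind: "\<And>c i. (\<Sum>i<n. c i *\<^sub>R b i) = 0 \<Longrightarrow> i < n \<Longrightarrow> c i = 0"
  shows "ordered_basis n u b"
proof -
  have inj: "inj_on b {..<n}"
  proof (rule inj_onI, rule ccontr)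
    fix i j assume ij: "i \<in> {..<n}" "j \<in> {..<n}" "b i = b j" "i \<noteq> j"
    let ?c = "\<lambda>k. (if k = i then 1 else 0) - (if k = j then 1 else 0) :: real"
    have "(\<Sum>k<n. ?c k *\<^sub>R b k) = (\<Sum>k<n. (if k = i then b k else 0)) - (\<Sum>k<n. (if k = j then b k else 0))"
      unfolding sum_subtractf[symmetric] by (intro sum.cong) (auto simp: algebra_simps)
    also have "\<dots> = 0" using ij by simp
    finally have "?c i = 0" using ind[of ?c i] ij by blast
    then show False using ij by simp
  qed
  have indep: "independent (b ` {..<n})"
  proof
    assume "dependent (b ` {..<n})"
    then obtain v where v: "\<exists>x\<in>b ` {..<n}. v x \<noteq> 0" "(\<Sum>x\<in>b ` {..<n}. v x *\<^sub>R x) = 0"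
      by (auto simp: dependent_finite)
    have "(\<Sum>i<n. v (b i) *\<^sub>R b i) = 0"
      using v(2) by (simp add: sum.reindex[OF inj])
    then show False using ind[of "\<lambda>i. v (b i)"] v(1) by auto
  qed
  have "card (b ` {..<n}) = n" using inj by (simp add: card_image)
  then have "u \<subseteq> span (b ` {..<n})"
    using u b indep by (intro card_ge_dim_independent) auto
  moreover have "span (b ` {..<n}) \<subseteq> u"
    using u b by (intro span_minimal) auto
  ultimately show ?thesis using inj indep b by (auto simp: ordered_basis_def)
qed

lemma ordered_basis_coords:
  assumes "ordered_basis n u b" "w \<in> u"
  obtains c where "w = (\<Sum>i<n. c i *\<^sub>R b i)"
proof -
  have "w \<in> span (b ` {..<n})" and inj: "inj_on b {..<n}"
    using assms by (auto simp: ordered_basis_def)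
  then obtain v where "w = (\<Sum>x\<in>b ` {..<n}. v x *\<^sub>R x)"
    by (auto simp: span_finite)
  then have "w = (\<Sum>i<n. v (b i) *\<^sub>R b i)"
    by (simp add: sum.reindex[OF inj])
  then show ?thesis by (rule that)
qed

lemma ordered_basis_zero:
  assumes "ordered_basis n u b" "(\<Sum>i<n. c i *\<^sub>R b i) = 0" "i < n"
  shows "c i = 0"
proof -
  have inj: "inj_on b {..<n}" and ind: "independent (b ` {..<n})"
    using assms by (auto simp: ordered_basis_def)
  let ?v = "\<lambda>x. c (inv_into {..<n} b x)"
  have "(\<Sum>x\<in>b ` {..<n}. ?v x *\<^sub>R x) = (\<Sum>i<n. c i *\<^sub>R b i)"
    unfolding sum.reindex[OF inj] by (intro sum.cong) (auto simp: inv_into_f_f[OF inj])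
  then have "\<forall>x\<in>b ` {..<n}. ?v x = 0"
    using ind assms(2) by (auto simp: dependent_finite)
  then show ?thesis using assms(3) by (auto simp: inv_into_f_f[OF inj])
qed

lemma ordered_basis_unique:
  assumes "ordered_basis n u b" "(\<Sum>i<n. c i *\<^sub>R b i) = (\<Sum>i<n. d i *\<^sub>R b i)" "i < n"
  shows "c i = d i"
  using ordered_basis_zero[OF assms(1), of "\<lambda>i. c i - d i"] assms(2,3)
  by (simp add: scaleR_diff_left sum_subtractf)

lemma ordered_basis_exists:
  fixes u :: "'a::euclidean_space set"
  assumes "subspace u" "dim u = n"
  obtains b where "ordered_basis n u b"
proof -
  obtain B where B: "B \<subseteq> u" "independent B" "u \<subseteq> span B" "card B = dim u"
    using basis_exists by blast
  then obtain b where b: "bij_betw b {..<n} B"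
    using assms(2) by (metis bij_betw_from_nat_into_finite finiteI_independent)
  have "span B = u"
    using B assms(1) by (metis span_subspace)
  then have "ordered_basis n u b"
    using b B by (auto simp: ordered_basis_def bij_betw_def)
  then show ?thesis by (rule that)
qed

lemma matrix_wrt_exists:
  assumes b: "ordered_basis n u b" and T: "\<And>x. x \<in> u \<Longrightarrow> T x \<in> u"
  obtains M where "is_matrix_wrt n b T M"
proof -
  have "\<exists>c. T (b j) = (\<Sum>i<n. c i *\<^sub>R b i)" if "j < n" for j
    using ordered_basis_coords[OF b, of "T (b j)"] T that b by (metis ordered_basis_def)
  then obtain c where "\<And>j. j < n \<Longrightarrow> T (b j) = (\<Sum>i<n. c j i *\<^sub>R b i)"
    by metis
  then have "is_matrix_wrt n b T (mat n n (\<lambda>(i, j). c j i))"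
    by (simp add: is_matrix_wrt_def)
  then show ?thesis by (rule that)
qed

section \<open>Alternating three-forms\<close>

text \<open>All the algebra on \<open>u\<close> rests on these axioms; the pullbacks of both model
  forms are instances, which keeps \<epsilon> out of the argument.\<close>

locale alternating3 =
  fixes F :: "'a::euclidean_space \<Rightarrow> 'a \<Rightarrow> 'a \<Rightarrow> real"
  assumes swap12: "F y x z = - F x y z" and swap23: "F x z y = - F x y z"
    and linear1: "linear (\<lambda>x. F x y z)"
begin

lemma linear2: "linear (\<lambda>y. F x y z)"
  using linear_compose_neg[OF linear1[of x z]] by (simp add: swap12[of x])

lemma linear3: "linear (\<lambda>z. F x y z)"
  using linear_compose_neg[OF linear2[of x y]] by (simp add: swap23[of x y])

lemma repeat [simp]: "F x x z = 0" "F x z z = 0" "F x z x = 0"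
  using swap12[of x x z] swap23[of x z z] swap23[of x z x] swap12[of x x z] by linarith+

lemmas add = linear_add[OF linear1] linear_add[OF linear2] linear_add[OF linear3]
lemmas diff = linear_diff[OF linear1] linear_diff[OF linear2] linear_diff[OF linear3]
lemmas neg = linear_neg[OF linear1] linear_neg[OF linear2] linear_neg[OF linear3]
lemmas scale = linear_scale[OF linear1] linear_scale[OF linear2] linear_scale[OF linear3]
lemmas zero [simp] = linear_0[OF linear1] linear_0[OF linear2] linear_0[OF linear3]

text \<open>Brackets inside \<open>u\<close> vanish, so the differential is decided by its values
  with \<open>f7\<close> in one slot and elements of \<open>u\<close> in the others. There it is, up
  to sign, the derivation action of \<open>br f7\<close> on the form.\<close>

lemma calibrated_iff:
  assumes br: "lie_algebra br" and u: "abelian_ideal br u"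
    and dec: "\<And>x. \<exists>y\<in>u. \<exists>t. x = y + t *\<^sub>R f7"
  shows "calibrated br (\<lambda>x. F (x 0) (x 1) (x 2)) \<longleftrightarrow>
    (\<forall>x\<in>u. \<forall>y\<in>u. \<forall>z\<in>u. F (br f7 x) y z + F x (br f7 y) z + F x y (br f7 z) = 0)"
proof
  assume cal: "calibrated br (\<lambda>x. F (x 0) (x 1) (x 2))"
  show "\<forall>x\<in>u. \<forall>y\<in>u. \<forall>z\<in>u. F (br f7 x) y z + F x (br f7 y) z + F x y (br f7 z) = 0"
  proof (intro ballI)
    fix x y z assume xyz: "x \<in> u" "y \<in> u" "z \<in> u"
    have "br x y = 0" "br x z = 0" "br y z = 0"
      using u xyz by (auto simp: abelian_ideal_def)
    moreover have "d3 br (\<lambda>x. F (x 0) (x 1) (x 2))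
        (\<lambda>i. if i = 0 then f7 else if i = 1 then x else if i = 2 then y else z) = 0"
      using cal by (simp add: calibrated_def)
    ultimately show "F (br f7 x) y z + F x (br f7 y) z + F x y (br f7 z) = 0"
      using swap12[of "br f7 y" x z] swap12[of "br f7 z" x y] swap23[of x "br f7 z" y]
      by (simp add: d3_def sq3_def)
  qed
next
  assume der: "\<forall>x\<in>u. \<forall>y\<in>u. \<forall>z\<in>u. F (br f7 x) y z + F x (br f7 y) z + F x y (br f7 z) = 0"
  have lin: "linear (br x)" "linear (\<lambda>x. br x y)" and anti: "br x y = - br y x" for x y
    using br unfolding lie_algebra_def by blast+
  have self: "br f7 f7 = 0"
    using anti[of f7 f7] by (simp add: eq_neg_iff_add_eq_0 flip: scaleR_2)
  have der': "F (br f7 x) y z - F (br f7 y) x z + F (br f7 z) x y = 0"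
    if "x \<in> u" "y \<in> u" "z \<in> u" for x y z
    using der that swap12[of "br f7 y" x z] swap12[of "br f7 z" x y] swap23[of x "br f7 z" y] by simp
  have expand: "br (y + s *\<^sub>R f7) (z + t *\<^sub>R f7) = s *\<^sub>R br f7 z - t *\<^sub>R br f7 y"
    if "y \<in> u" "z \<in> u" for y z s t
  proof -
    have "br y z = 0" using u that by (auto simp: abelian_ideal_def)
    then show ?thesis
      using anti[of y f7] self
      by (simp add: linear_add[OF lin(1)] linear_add[OF lin(2)] linear_scale[OF lin(1)] linear_scale[OF lin(2)])
  qed
  show "calibrated br (\<lambda>x. F (x 0) (x 1) (x 2))"
    unfolding calibrated_def
  proof
    fix x :: "nat \<Rightarrow> 'a"
    obtain y t where y: "\<And>i. y i \<in> u" and x: "\<And>i. x i = y i + t i *\<^sub>R f7"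
      using dec[of "x _"] by metis
    have sw: "F p (y 1) (y 0) = - F p (y 0) (y 1)" "F p (y 2) (y 0) = - F p (y 0) (y 2)"
      "F p (y 3) (y 0) = - F p (y 0) (y 3)" "F p (y 2) (y 1) = - F p (y 1) (y 2)"
      "F p (y 3) (y 1) = - F p (y 1) (y 3)" "F p (y 3) (y 2) = - F p (y 2) (y 3)"
      "F p f7 (y 0) = - F p (y 0) f7" "F p f7 (y 1) = - F p (y 1) f7"
      "F p f7 (y 2) = - F p (y 2) f7" "F p f7 (y 3) = - F p (y 3) f7" for p
      by (rule swap23)+
    \<comment> \<open>A product \<open>t i * t j\<close> arises once from the bracket that takes
      \<open>f7\<close> from slot i and once from the one that takes it from slot j, with opposite
      signs. What remains is linear in \<open>t\<close>.\<close>
    have "d3 br (\<lambda>x. F (x 0) (x 1) (x 2)) x =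
        - t 0 * (F (br f7 (y 1)) (y 2) (y 3) - F (br f7 (y 2)) (y 1) (y 3) + F (br f7 (y 3)) (y 1) (y 2))
        + t 1 * (F (br f7 (y 0)) (y 2) (y 3) - F (br f7 (y 2)) (y 0) (y 3) + F (br f7 (y 3)) (y 0) (y 2))
        - t 2 * (F (br f7 (y 0)) (y 1) (y 3) - F (br f7 (y 1)) (y 0) (y 3) + F (br f7 (y 3)) (y 0) (y 1))
        + t 3 * (F (br f7 (y 0)) (y 1) (y 2) - F (br f7 (y 1)) (y 0) (y 2) + F (br f7 (y 2)) (y 0) (y 1))"
      unfolding d3_def sq3_def x expand[OF y y]
      by (simp add: add diff scale sw del: One_nat_def) (simp add: algebra_simps)
    then show "d3 br (\<lambda>x. F (x 0) (x 1) (x 2)) x = 0"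
      by (simp add: der' y)
  qed
qed

text \<open>The commutator \<open>K = T J - J T\<close> anticommutes with \<open>J\<close>, and \<open>F\<close> is symmetric with respect
  to both maps. Moving \<open>J\<close> and \<open>K\<close> through the three slots of \<open>F\<close> changes the sign
  of \<open>F (K x) (J y) z\<close>.\<close>

lemma commutator_degenerate:
  assumes u: "subspace u" and J: "linear J" "\<And>x. x \<in> u \<Longrightarrow> J x \<in> u" "\<And>x. x \<in> u \<Longrightarrow> J (J x) = - x"
    and FJ: "\<And>x y z. x \<in> u \<Longrightarrow> y \<in> u \<Longrightarrow> z \<in> u \<Longrightarrow> F (J x) y z = F x (J y) z"
    and T: "linear T" "\<And>x. x \<in> u \<Longrightarrow> T x \<in> u"
    and der: "\<And>x y z. x \<in> u \<Longrightarrow> y \<in> u \<Longrightarrow> z \<in> u \<Longrightarrow> F (T x) y z + F x (T y) z + F x y (T z) = 0"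
    and xyz: "x \<in> u" "y \<in> u" "z \<in> u"
  shows "F (T (J x) - J (T x)) y z = 0"
proof -
  define K where "K x = T (J x) - J (T x)" for x
  have Ku: "K x \<in> u" if "x \<in> u" for x
    unfolding K_def using that u J(2) T(2) by (simp add: subspace_diff)
  have neg_u: "- x \<in> u" if "x \<in> u" for x
    using that u by (simp add: subspace_neg)
  have KJ: "K (J x) = - J (K x)" if "x \<in> u" for x
    unfolding K_def using that J T
    by (simp add: linear_neg[OF T(1)] linear_diff[OF J(1)])
  have FJ13: "F (J x) y z = F x y (J z)" if "x \<in> u" "y \<in> u" "z \<in> u" for x y z
    using FJ[of x z y] that swap23[of "J x" y z] swap23[of x y "J z"] by simp
  have FJ23: "F x (J y) z = F x y (J z)" if "x \<in> u" "y \<in> u" "z \<in> u" for x y z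
    using FJ FJ13 that by metis
  \<comment> \<open>Subtract the derivation identity at \<open>(x, J y, z)\<close> from the one at
    \<open>(J x, y, z)\<close>; the terms without a commutator cancel by moving \<open>J\<close>
    between slots.\<close>
  have FK: "F (K x) y z = F x (K y) z" if "x \<in> u" "y \<in> u" "z \<in> u" for x y z
  proof -
    have "F (T (J x)) y z + F (J x) (T y) z + F (J x) y (T z) = 0"
      "F (T x) (J y) z + F x (T (J y)) z + F x (J y) (T z) = 0"
      using that J T der by auto
    moreover have "F (J x) (T y) z = F x (J (T y)) z" "F (J x) y (T z) = F x (J y) (T z)"
      "F (J (T x)) y z = F (T x) (J y) z"
      using that T FJ by auto
    ultimately show ?thesis by (simp add: K_def diff)
  qed
  have zero: "F (K x) y (J z) = 0" if "x \<in> u" "y \<in> u" "z \<in> u" for x y z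
  proof -
    have "F (K x) y (J z) = F (K x) (J y) z" using FJ23 Ku that by simp
    also have "\<dots> = F x (K (J y)) z" using FK J that by simp
    also have "\<dots> = - F x (J (K y)) z" by (simp add: KJ that neg)
    also have "\<dots> = - F x (K y) (J z)" using FJ23 Ku that by simp
    also have "\<dots> = - F (K x) y (J z)" using FK J that by simp
    finally show ?thesis by simp
  qed
  have "F (K x) y (J (J z)) = 0"
    using zero xyz J by blast
  then show ?thesis using xyz J by (simp add: K_def neg)
qed

text \<open>The functional \<open>L i\<close> inserts a vector into slot i of the nonzero triple. It
  sees only the coordinates along \<open>X i\<close> and \<open>J (X i)\<close>, with weights
  \<open>p\<close> and \<open>q\<close>, which are, up to the sign of \<open>q\<close>, the real and
  imaginary parts of the complex volume of the triple. The pair \<open>L i w\<close>,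
  \<open>L i (J w)\<close> therefore determines both coordinates, and this one device yields the
  basis, the commutation with \<open>J\<close> and the two traces.\<close>

lemma complex_structure_matrix:
  assumes u: "subspace u" "dim u = 6"
    and J: "linear J" "\<And>x. x \<in> u \<Longrightarrow> J x \<in> u" "\<And>x. x \<in> u \<Longrightarrow> J (J x) = - x"
    and FJ: "\<And>x y z. x \<in> u \<Longrightarrow> y \<in> u \<Longrightarrow> z \<in> u \<Longrightarrow> F (J x) y z = F x (J y) z"
    and T: "linear T" "\<And>x. x \<in> u \<Longrightarrow> T x \<in> u"
    and der: "\<And>x y z. x \<in> u \<Longrightarrow> y \<in> u \<Longrightarrow> z \<in> u \<Longrightarrow> F (T x) y z + F x (T y) z + F x y (T z) = 0"
    and x: "x0 \<in> u" "x1 \<in> u" "x2 \<in> u" "F x0 x1 x2 \<noteq> 0"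
  shows "\<exists>A B b. A \<in> carrier_mat 3 3 \<and> B \<in> carrier_mat 3 3 \<and> mtrace A = 0 \<and> mtrace B = 0 \<and>
    ordered_basis 6 u b \<and> is_matrix_wrt 6 b T (four_block_mat A B (- B) A)"
proof -
  define p where "p = F x0 x1 x2"
  define q where "q = F (J x0) x1 x2"
  define X where "X i = (if i = 0 then x0 else if i = 1 then x1 else x2)" for i :: nat
  define L where "L i w = (if i = 0 then F w x1 x2 else if i = 1 then F x0 w x2 else F x0 x1 w)"
    for i :: nat and w
  define b where "b i = (if i < 3 then X i else J (X (i - 3)))" for i
  have p: "p \<noteq> 0" using x by (simp add: p_def)
  \<comment> \<open>The hypotheses are the real part and, up to sign, the imaginary part of
    \<open>(a + \<i> c) (p - \<i> q) = 0\<close>, where \<open>p\<close> is nonzero.\<close>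
  have cancel: "a = 0 \<and> c = 0" if "a * p + c * q = 0" "a * q - c * p = 0" for a c
  proof -
    have "a * (p * p + q * q) = (a * p + c * q) * p + (a * q - c * p) * q"
      "c * (p * p + q * q) = (a * p + c * q) * q - (a * q - c * p) * p"
      by (simp_all add: algebra_simps)
    moreover have "p * p + q * q > 0" using p by (metis add_pos_nonneg not_real_square_gt_zero zero_le_square)
    ultimately show ?thesis using that by auto
  qed
  have Xu: "X i \<in> u" for i using x by (simp add: X_def)
  have FJ13: "F (J x) y z = F x y (J z)" if "x \<in> u" "y \<in> u" "z \<in> u" for x y z
    using FJ[of x z y] that swap23[of "J x" y z] swap23[of x y "J z"] by simp
  have FJ23: "F x (J y) z = F x y (J z)" if "x \<in> u" "y \<in> u" "z \<in> u" for x y z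
    using FJ FJ13 that by metis
  have linL: "linear (L i)" for i
    unfolding L_def[abs_def] using linear1[of x1 x2] linear2[of x0 x2] linear3[of x0 x1]
    by (cases "i = 0"; cases "i = 1") simp_all
  \<comment> \<open>Moving \<open>J\<close> to the neighbouring slot gives
    \<open>F (J y) y z = F y (J y) z\<close>, and swapping the two arguments gives the negative; the
    other cases are permutations of this one.\<close>
  have half: "F (J y) y z = 0" "F y (J y) z = 0" "F z (J y) y = 0" "F z y (J y) = 0"
    "F y z (J y) = 0" "F (J y) z y = 0" if "y \<in> u" "z \<in> u" for y z
    using FJ[OF that(1,1,2)] FJ23[OF that(2,1,1)] FJ13[OF that(1,2,1)] swap12[of "J y" y z]
      swap23[of z "J y" y] swap23[of "J y" y z] swap23[of y "J y" z]
    by linarith+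
  have LX: "L i (X j) = (if i = j then p else 0)" if "i < 3" "j < 3" for i j
    using that by (auto simp: L_def X_def p_def)
  have LJX: "L i (J (X j)) = (if i = j then q else 0)" if "i < 3" "j < 3" for i j
    using that x FJ FJ13 FJ23 by (auto simp: L_def X_def q_def half)
  have Lw: "L i (\<Sum>j<3. a j *\<^sub>R X j + c j *\<^sub>R J (X j)) = a i * p + c i * q" if "i < 3" for i a c
  proof -
    have "L i (\<Sum>j<3. a j *\<^sub>R X j + c j *\<^sub>R J (X j))
        = (\<Sum>j<3. (if i = j then a j * p + c j * q else 0))"
      unfolding linear_sum[OF linL] using that
      by (intro sum.cong) (auto simp: linear_add[OF linL] linear_scale[OF linL] LX LJX)
    then show ?thesis using that by simp
  qed
  have Jw: "J (\<Sum>j<3. a j *\<^sub>R X j + c j *\<^sub>R J (X j)) = (\<Sum>j<3. (- c j) *\<^sub>R X j + a j *\<^sub>R J (X j))" for a c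
    unfolding linear_sum[OF J(1)]
    by (intro sum.cong) (auto simp: linear_add[OF J(1)] linear_scale[OF J(1)] J Xu)
  have LJw: "L i (J (\<Sum>j<3. a j *\<^sub>R X j + c j *\<^sub>R J (X j))) = a i * q - c i * p" if "i < 3" for i a c
    unfolding Jw Lw[OF that] by simp
  have sum6: "(\<Sum>i<6. c i *\<^sub>R b i) = (\<Sum>j<3. c j *\<^sub>R X j + c (j + 3) *\<^sub>R J (X j))" for c
    by (simp add: b_def lessThan_Suc numeral_eq_Suc add_ac)
  have basis: "ordered_basis 6 u b"
  proof (rule ordered_basisI[OF u])
    show "b i \<in> u" for i using Xu J by (simp add: b_def)
    fix c i assume c: "(\<Sum>i<6. c i *\<^sub>R b i) = 0" and i: "i < (6::nat)"
    have "c k = 0 \<and> c (k + 3) = 0" if "k < 3" for k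
      using Lw[OF that, of c "\<lambda>j. c (j + 3)"] LJw[OF that, of c "\<lambda>j. c (j + 3)"] c
      unfolding sum6[symmetric]
      by (intro cancel) (simp_all add: linear_0[OF linL] linear_0[OF J(1)])
    from this[of i] this[of "i - 3"] show "c i = 0" using i by (cases "i < 3") auto
  qed
  have coords: "\<exists>a c. w = (\<Sum>j<3. a j *\<^sub>R X j + c j *\<^sub>R J (X j))" if "w \<in> u" for w
  proof -
    obtain c where "w = (\<Sum>i<6. c i *\<^sub>R b i)"
      using ordered_basis_coords[OF basis \<open>w \<in> u\<close>] by blast
    then show ?thesis unfolding sum6 by (intro exI[of _ c] exI[of _ "\<lambda>j. c (j + 3)"])
  qed
  have comm: "T (J x) = J (T x)" if "x \<in> u" for x
  proof -
    \<comment> \<open>Inserting \<open>w\<close> or \<open>J w\<close> into any slot gives zero, so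
      all \<open>L i w\<close> and \<open>L i (J w)\<close> vanish, and with them the coordinates of
      \<open>w\<close>.\<close>
    define w where "w = T (J x) - J (T x)"
    have wu: "w \<in> u" unfolding w_def using that u J T by (simp add: subspace_diff)
    have deg: "F w y z = 0" if "y \<in> u" "z \<in> u" for y z
      unfolding w_def by (rule commutator_degenerate[OF u(1) J FJ T der]) (use that \<open>x \<in> u\<close> in auto)
    have "L i w = 0" for i
      using deg x swap12[of x0 w x2] swap23[of x0 x1 w] swap12[of x0 w x1] by (simp add: L_def)
    moreover have "F (J w) y z = 0" if "y \<in> u" "z \<in> u" for y z
      using FJ[of w y z] deg J that wu by simp
    then have "L i (J w) = 0" for i
      using x swap12[of x0 "J w" x2] swap23[of x0 x1 "J w"] swap12[of x0 "J w" x1] by (simp add: L_def)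
    moreover obtain a c where w: "w = (\<Sum>j<3. a j *\<^sub>R X j + c j *\<^sub>R J (X j))"
      using coords[OF wu] by blast
    ultimately have "a i * p + c i * q = 0" "a i * q - c i * p = 0" if "i < 3" for i
      using Lw[OF that] LJw[OF that] by metis+
    then have "a i = 0 \<and> c i = 0" if "i < 3" for i
      using cancel that by blast
    then have "w = 0" unfolding w by (intro sum.neutral) simp
    then show ?thesis by (simp add: w_def)
  qed
  have "\<exists>a c. T (X j) = (\<Sum>i<3. a i *\<^sub>R X i + c i *\<^sub>R J (X i))" for j
    using coords T Xu by blast
  then obtain a c where TX: "\<And>j. T (X j) = (\<Sum>i<3. a j i *\<^sub>R X i + c j i *\<^sub>R J (X i))"
    by metis
  have "F (T x0) x1 x2 + F x0 (T x1) x2 + F x0 x1 (T x2) = 0"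
    using der x by blast
  then have "L 0 (T (X 0)) + L 1 (T (X 1)) + L 2 (T (X 2)) = 0"
    by (simp add: L_def X_def)
  then have t1: "(a 0 0 + a 1 1 + a 2 2) * p + (c 0 0 + c 1 1 + c 2 2) * q = 0"
    unfolding TX by (simp add: Lw algebra_simps)
  \<comment> \<open>One real equation cannot kill a complex trace. Replacing \<open>x0\<close> by
    \<open>J x0\<close> supplies the second one, and \<open>cancel\<close> applies to the two trace
    sums.\<close>
  have "F (T (J x0)) x1 x2 + F (J x0) (T x1) x2 + F (J x0) x1 (T x2) = 0"
    using der J x by blast
  then have "L 0 (J (T (X 0))) + L 1 (J (T (X 1))) + L 2 (J (T (X 2))) = 0"
    using x T comm FJ[of x0 "T x1" x2] FJ13[of x0 x1 "T x2"] by (simp add: L_def X_def)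
  then have t2: "(a 0 0 + a 1 1 + a 2 2) * q - (c 0 0 + c 1 1 + c 2 2) * p = 0"
    unfolding TX by (simp add: LJw algebra_simps)
  have tr: "a 0 0 + a 1 1 + a 2 2 = 0" "c 0 0 + c 1 1 + c 2 2 = 0"
    using cancel[OF t1 t2] by auto
  define A where "A = mat 3 3 (\<lambda>(i, j). a j i)"
  \<comment> \<open>The coefficients \<open>c\<close> of the vectors \<open>J (X i)\<close> fill the
    lower left block, which is \<open>- B\<close>; hence the sign.\<close>
  define B where "B = mat 3 3 (\<lambda>(i, j). - c j i)"
  have A: "A \<in> carrier_mat 3 3" and B: "B \<in> carrier_mat 3 3" by (simp_all add: A_def B_def)
  have "mtrace A = 0"
    using tr(1) by (simp add: mtrace_def A_def lessThan_Suc numeral_eq_Suc algebra_simps)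
  moreover have "mtrace B = 0"
    using tr(2) by (simp add: mtrace_def B_def lessThan_Suc numeral_eq_Suc algebra_simps)
  moreover have "is_matrix_wrt 6 b T (four_block_mat A B (- B) A)"
    unfolding is_matrix_wrt_def
  proof (intro conjI allI impI)
    show "four_block_mat A B (- B) A \<in> carrier_mat 6 6"
      using four_block_carrier_mat[OF A A, of B "- B"] by simp
    fix j :: nat assume j: "j < 6"
    show "T (b j) = (\<Sum>i<6. four_block_mat A B (- B) A $$ (i, j) *\<^sub>R b i)"
    proof (cases "j < 3")
      case True
      then show ?thesis
        unfolding sum6 using A B j
        by (simp add: b_def TX) (intro sum.cong; simp add: A_def B_def)
    next
      case False
      then have j3: "j - 3 < 3" using j by simp
      have "T (b j) = (\<Sum>i<3. (- c (j - 3) i) *\<^sub>R X i + a (j - 3) i *\<^sub>R J (X i))"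
        using False by (simp add: b_def comm Xu TX Jw)
      also have "\<dots> = (\<Sum>i<6. four_block_mat A B (- B) A $$ (i, j) *\<^sub>R b i)"
        unfolding sum6 using A B j j3 False
        by (intro sum.cong) (simp_all add: A_def B_def)
      finally show ?thesis .
    qed
  qed
  ultimately show ?thesis using A B basis by blast
qed

end

section \<open>Change of basis and similarity\<close>

lemma linear_combination_matrix:
  fixes b :: "nat \<Rightarrow> 'a::real_vector"
  shows "(\<Sum>j<n. c j *\<^sub>R (\<Sum>i<n. R $$ (i, j) *\<^sub>R b i)) = (\<Sum>i<n. (\<Sum>j<n. R $$ (i, j) * c j) *\<^sub>R b i)"
proof -
  have "(\<Sum>j<n. c j *\<^sub>R (\<Sum>i<n. R $$ (i, j) *\<^sub>R b i)) = (\<Sum>j<n. \<Sum>i<n. (R $$ (i, j) * c j) *\<^sub>R b i)"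
    by (simp add: scaleR_sum_right mult.commute)
  also have "\<dots> = (\<Sum>i<n. \<Sum>j<n. (R $$ (i, j) * c j) *\<^sub>R b i)"
    by (rule sum.swap)
  finally show ?thesis by (simp add: scaleR_sum_left)
qed

lemma mult_mat_index:
  assumes "A \<in> carrier_mat n n" "B \<in> carrier_mat n n" "i < n" "j < n"
  shows "(A * B) $$ (i, j) = (\<Sum>k<n. A $$ (i, k) * B $$ (k, j))"
  using assms by (auto simp: scalar_prod_def atLeast0LessThan intro!: sum.cong)

lemma matrix_change_of_basis:
  fixes b :: "nat \<Rightarrow> 'a::euclidean_space"
  assumes b: "ordered_basis n u b" and M: "is_matrix_wrt n b T M" and T: "linear T"
    and R: "R \<in> carrier_mat n n" "S \<in> carrier_mat n n" "S * R = 1\<^sub>m n"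
    and N: "N \<in> carrier_mat n n" "M * R = R * N"
  obtains b' where "ordered_basis n u b'" "is_matrix_wrt n b' T N"
proof -
  define b' where "b' j = (\<Sum>i<n. R $$ (i, j) *\<^sub>R b i)" for j
  have Mc: "M \<in> carrier_mat n n" using M by (simp add: is_matrix_wrt_def)
  have u: "subspace u" "dim u = n"
    using b by (auto simp: ordered_basis_def card_image dim_eq_card_independent)
  have bu: "b i \<in> u" if "i < n" for i using b that by (simp add: ordered_basis_def)
  have "ordered_basis n u b'"
  proof (rule ordered_basisI[OF u])
    show "b' i \<in> u" for i
      unfolding b'_def using u bu by (intro subspace_sum subspace_scale) auto
    fix c i assume c: "(\<Sum>i<n. c i *\<^sub>R b' i) = 0" and i: "i < n"
    have Rc: "(\<Sum>j<n. R $$ (k, j) * c j) = 0" if "k < n" for k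
      using ordered_basis_zero[OF b c[unfolded b'_def linear_combination_matrix] that] .
    have "c i = (\<Sum>j<n. if j = i then c j else 0)" using i by simp
    also have "\<dots> = (\<Sum>j<n. (S * R) $$ (i, j) * c j)"
      using i R by (intro sum.cong) auto
    also have "\<dots> = (\<Sum>j<n. \<Sum>k<n. S $$ (i, k) * (R $$ (k, j) * c j))"
      using i R(1,2)
      by (intro sum.cong) (auto simp del: index_mult_mat simp: mult_mat_index sum_distrib_right mult.assoc)
    also have "\<dots> = (\<Sum>k<n. S $$ (i, k) * (\<Sum>j<n. R $$ (k, j) * c j))"
      by (subst sum.swap) (simp add: sum_distrib_left)
    finally show "c i = 0" by (simp add: Rc)
  qed
  moreover have "T (b' j) = (\<Sum>i<n. N $$ (i, j) *\<^sub>R b' i)" if j: "j < n" for j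
  proof -
    have "T (b' j) = (\<Sum>k<n. R $$ (k, j) *\<^sub>R (\<Sum>i<n. M $$ (i, k) *\<^sub>R b i))"
      unfolding b'_def linear_sum[OF T] linear_scale[OF T]
      using M by (intro sum.cong) (auto simp: is_matrix_wrt_def)
    also have "\<dots> = (\<Sum>i<n. (M * R) $$ (i, j) *\<^sub>R b i)"
      unfolding linear_combination_matrix using Mc R j
      by (intro sum.cong) (auto simp del: index_mult_mat simp: mult_mat_index)
    also have "\<dots> = (\<Sum>i<n. (R * N) $$ (i, j) *\<^sub>R b i)" by (simp only: N)
    also have "\<dots> = (\<Sum>i<n. N $$ (i, j) *\<^sub>R b' i)"
      unfolding b'_def linear_combination_matrix using N R j
      by (intro sum.cong) (auto simp del: index_mult_mat simp: mult_mat_index)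
    finally show ?thesis .
  qed
  ultimately show ?thesis using that N by (auto simp: is_matrix_wrt_def)
qed

text \<open>Statement (iv) speaks of the matrix with respect to an arbitrary basis, whereas (iii)
  provides one particular basis; this links the two.\<close>

lemma matrices_wrt_similar:
  fixes b b' :: "nat \<Rightarrow> 'a::euclidean_space"
  assumes b: "ordered_basis n u b" and M: "is_matrix_wrt n b T M" and T: "linear T"
    and b': "ordered_basis n u b'" and N: "is_matrix_wrt n b' T N"
  shows "similar_mat M N"
proof -
  have trans: "\<exists>P. P \<in> carrier_mat n n \<and> (\<forall>j<n. b2 j = (\<Sum>i<n. P $$ (i, j) *\<^sub>R b1 i))"
    if 1: "ordered_basis n u b1" and 2: "ordered_basis n u b2" for b1 b2 :: "nat \<Rightarrow> 'a"
  proof -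
    have "\<exists>c. b2 j = (\<Sum>i<n. c i *\<^sub>R b1 i)" if "j < n" for j
      using ordered_basis_coords[OF 1, of "b2 j"] 2 that by (metis ordered_basis_def)
    then obtain c where "\<And>j. j < n \<Longrightarrow> b2 j = (\<Sum>i<n. c j i *\<^sub>R b1 i)" by metis
    then show ?thesis by (intro exI[of _ "mat n n (\<lambda>(i, j). c j i)"]) simp
  qed
  have inverse: "P * Q = 1\<^sub>m n"
    if 1: "ordered_basis n u b1" and P: "P \<in> carrier_mat n n" "\<forall>j<n. b2 j = (\<Sum>i<n. P $$ (i, j) *\<^sub>R b1 i)"
      and Q: "Q \<in> carrier_mat n n" "\<forall>j<n. b1 j = (\<Sum>i<n. Q $$ (i, j) *\<^sub>R b2 i)"
    for b1 b2 :: "nat \<Rightarrow> 'a" and P Q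
  proof (rule eq_matI)
    fix i j assume "i < dim_row (1\<^sub>m n :: real mat)" "j < dim_col (1\<^sub>m n :: real mat)"
    then have ij: "i < n" "j < n" by simp_all
    have "(\<Sum>i<n. (1\<^sub>m n $$ (i, j)) *\<^sub>R b1 i) = (\<Sum>i<n. (if i = j then b1 i else 0))"
      using ij by (intro sum.cong) auto
    also have "\<dots> = b1 j" using ij by simp
    also have "\<dots> = (\<Sum>k<n. Q $$ (k, j) *\<^sub>R (\<Sum>i<n. P $$ (i, k) *\<^sub>R b1 i))"
      unfolding Q(2)[rule_format, OF ij(2)] using P by (intro sum.cong) auto
    also have "\<dots> = (\<Sum>i<n. (P * Q) $$ (i, j) *\<^sub>R b1 i)"
      unfolding linear_combination_matrix using P Q ij
      by (intro sum.cong) (auto simp del: index_mult_mat simp: mult_mat_index)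
    finally show "(P * Q) $$ (i, j) = 1\<^sub>m n $$ (i, j)"
      using ordered_basis_unique[OF 1 _ ij(1)] by metis
  qed (use P Q in auto)
  obtain P where P: "P \<in> carrier_mat n n" "\<forall>j<n. b' j = (\<Sum>i<n. P $$ (i, j) *\<^sub>R b i)"
    using trans[OF b b'] by blast
  obtain Q where Q: "Q \<in> carrier_mat n n" "\<forall>j<n. b j = (\<Sum>i<n. Q $$ (i, j) *\<^sub>R b' i)"
    using trans[OF b' b] by blast
  have PQ: "P * Q = 1\<^sub>m n" "Q * P = 1\<^sub>m n"
    using inverse[OF b P Q] inverse[OF b' Q P] by auto
  have Mc: "M \<in> carrier_mat n n" and Nc: "N \<in> carrier_mat n n"
    using M N by (auto simp: is_matrix_wrt_def)
  have MP: "M * P = P * N"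
  proof (rule eq_matI)
    fix i j assume "i < dim_row (P * N)" "j < dim_col (P * N)"
    then have ij: "i < n" "j < n" using P Nc by auto
    have "(\<Sum>i<n. (M * P) $$ (i, j) *\<^sub>R b i) = (\<Sum>k<n. P $$ (k, j) *\<^sub>R (\<Sum>i<n. M $$ (i, k) *\<^sub>R b i))"
      unfolding linear_combination_matrix using P Mc ij
      by (intro sum.cong) (auto simp del: index_mult_mat simp: mult_mat_index)
    also have "\<dots> = T (b' j)"
      unfolding P(2)[rule_format, OF ij(2)] linear_sum[OF T] linear_scale[OF T]
      using M by (intro sum.cong) (auto simp: is_matrix_wrt_def)
    also have "\<dots> = (\<Sum>k<n. N $$ (k, j) *\<^sub>R (\<Sum>i<n. P $$ (i, k) *\<^sub>R b i))"
      using N P(2) ij by (auto simp: is_matrix_wrt_def)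
    also have "\<dots> = (\<Sum>i<n. (P * N) $$ (i, j) *\<^sub>R b i)"
      unfolding linear_combination_matrix using P Nc ij
      by (intro sum.cong) (auto simp del: index_mult_mat simp: mult_mat_index)
    finally show "(M * P) $$ (i, j) = (P * N) $$ (i, j)"
      using ordered_basis_unique[OF b _ ij(1)] by metis
  qed (use P Mc Nc in auto)
  have "M = M * (P * Q)" using PQ Mc by simp
  also have "\<dots> = P * N * Q"
    using MP P Q Mc by (metis assoc_mult_mat)
  finally show ?thesis
    using P Q PQ Mc Nc by (intro similar_matI[of _ _ P Q n]) auto
qed

text \<open>For real \<open>M\<close> and \<open>N\<close> the equation \<open>M P = P N\<close>
  splits, so the real and imaginary parts of \<open>P\<close> both intertwine \<open>M\<close> and
  \<open>N\<close>, and so does every real combination \<open>P1 + t P2\<close>. Each part may be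
  singular, so \<open>t\<close> has to be chosen with care.\<close>

lemma complex_similar_imp_real_similar:
  fixes M N :: "real mat"
  assumes M: "M \<in> carrier_mat n n" and N: "N \<in> carrier_mat n n"
    and sim: "similar_mat (map_mat complex_of_real M) (map_mat complex_of_real N)"
  obtains R S where "R \<in> carrier_mat n n" "S \<in> carrier_mat n n" "S * R = 1\<^sub>m n" "M * R = R * N"
proof -
  let ?c = "map_mat complex_of_real"
  have cM: "?c M \<in> carrier_mat n n" and cN: "?c N \<in> carrier_mat n n" using M N by auto
  obtain P Q where wit: "similar_mat_wit (?c M) (?c N) P Q"
    using sim unfolding similar_mat_def by blast
  note w = similar_mat_witD2[OF cM wit]
  have P: "P \<in> carrier_mat n n" "Q \<in> carrier_mat n n" "Q * P = 1\<^sub>m n"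
    by (fact w)+
  have "?c M * P = P * ?c N * Q * P"
    by (simp only: w(3))
  also have "\<dots> = P * ?c N * (Q * P)"
    using P cN by (intro assoc_mult_mat[of _ n n _ n _ n]) auto
  finally have "?c M * P = P * ?c N * (Q * P)" .
  then have MP: "?c M * P = P * ?c N"
    using P cN by simp
  have idx: "(\<Sum>k<n. complex_of_real (M $$ (i, k)) * P $$ (k, j)) = (\<Sum>k<n. P $$ (i, k) * complex_of_real (N $$ (k, j)))"
    if "i < n" "j < n" for i j
  proof -
    have "(?c M * P) $$ (i, j) = (\<Sum>k<n. complex_of_real (M $$ (i, k)) * P $$ (k, j))"
      "(P * ?c N) $$ (i, j) = (\<Sum>k<n. P $$ (i, k) * complex_of_real (N $$ (k, j)))"
      using M N P that by (subst mult_mat_index[of _ n]; auto intro!: sum.cong)+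
    then show ?thesis using MP by simp
  qed
  define P1 where "P1 = map_mat Re P"
  define P2 where "P2 = map_mat Im P"
  have P12: "P1 \<in> carrier_mat n n" "P2 \<in> carrier_mat n n" using P by (auto simp: P1_def P2_def)
  have R: "M * (P1 + t \<cdot>\<^sub>m P2) = (P1 + t \<cdot>\<^sub>m P2) * N" for t
  proof (rule eq_matI)
    fix i j assume "i < dim_row ((P1 + t \<cdot>\<^sub>m P2) * N)" "j < dim_col ((P1 + t \<cdot>\<^sub>m P2) * N)"
    then have ij: "i < n" "j < n" using P12 N by auto
    have 1: "(\<Sum>k<n. M $$ (i, k) * P1 $$ (k, j)) = (\<Sum>k<n. P1 $$ (i, k) * N $$ (k, j))"
      using arg_cong[OF idx[OF ij], of Re] P ij by (simp add: P1_def)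
    have 2: "(\<Sum>k<n. M $$ (i, k) * P2 $$ (k, j)) = (\<Sum>k<n. P2 $$ (i, k) * N $$ (k, j))"
      using arg_cong[OF idx[OF ij], of Im] P ij by (simp add: P2_def)
    have "(M * (P1 + t \<cdot>\<^sub>m P2)) $$ (i, j)
        = (\<Sum>k<n. M $$ (i, k) * P1 $$ (k, j)) + t * (\<Sum>k<n. M $$ (i, k) * P2 $$ (k, j))"
      using M P12 ij
      by (subst mult_mat_index[of _ n]) (auto simp: algebra_simps sum.distrib sum_distrib_left intro!: sum.cong)
    also have "\<dots> = ((P1 + t \<cdot>\<^sub>m P2) * N) $$ (i, j)"
      unfolding 1 2 using N P12 ij
      by (subst mult_mat_index[of _ n]) (auto simp: algebra_simps sum.distrib sum_distrib_left intro!: sum.cong)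
    finally show "(M * (P1 + t \<cdot>\<^sub>m P2)) $$ (i, j) = ((P1 + t \<cdot>\<^sub>m P2) * N) $$ (i, j)" .
  qed (use M N P12 in auto)
  text \<open>The polynomial \<open>det (P1 + t P2)\<close> does not vanish at \<open>t = \<i>\<close>, hence not at every real \<open>t\<close>.\<close>
  define W where "W = mat n n (\<lambda>ij. [:P1 $$ ij, P2 $$ ij:])"
  have "det W \<noteq> 0"
  proof
    assume 0: "det W = 0"
    interpret mp: map_poly_comm_ring_hom complex_of_real ..
    interpret h: comm_ring_hom "\<lambda>p. poly (map_poly complex_of_real p) \<i>"
      by unfold_locales (simp_all add: mp.hom_mult mp.hom_add)
    have "map_poly complex_of_real [:a, b:] = [:complex_of_real a, complex_of_real b:]" for a b
      by (rule poly_eqI) (simp add: coeff_map_poly coeff_pCons split: nat.split)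
    then have "map_mat (\<lambda>p. poly (map_poly complex_of_real p) \<i>) W = P"
      using P by (intro eq_matI) (auto simp: W_def P1_def P2_def complex_eq_iff)
    then have "det P = 0"
      using h.hom_det[of W] 0 by simp
    moreover have "det Q * det P = 1"
      using det_mult[OF P(2,1)] P(3) by simp
    ultimately show False by simp
  qed
  then obtain t where t: "poly (det W) t \<noteq> 0"
    using poly_all_0_iff_0 by blast
  have ph: "comm_ring_hom (\<lambda>p. poly p t)" by unfold_locales auto
  have "map_mat (\<lambda>p. poly p t) W = P1 + t \<cdot>\<^sub>m P2"
    using P12 by (intro eq_matI) (auto simp: W_def)
  then have d: "det (P1 + t \<cdot>\<^sub>m P2) \<noteq> 0"
    using comm_ring_hom.hom_det[OF ph, of W] t by simp
  have Rc: "P1 + t \<cdot>\<^sub>m P2 \<in> carrier_mat n n" using P12 by simp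
  obtain S where "S \<in> carrier_mat n n" "S * (P1 + t \<cdot>\<^sub>m P2) = 1\<^sub>m n"
    using det_non_zero_imp_unit[OF Rc d, of "()"] by (auto simp: Units_def ring_mat_def)
  then show ?thesis using that Rc R by blast
qed

section \<open>Trace and Jordan normal form\<close>

lemma mtrace_mult_commute:
  fixes A B :: "'a::comm_ring_1 mat"
  assumes A: "A \<in> carrier_mat n n" and B: "B \<in> carrier_mat n n"
  shows "mtrace (A * B) = mtrace (B * A)"
proof -
  have "mtrace (A * B) = (\<Sum>i<n. \<Sum>k<n. A $$ (i, k) * B $$ (k, i))"
    using A B by (auto simp del: index_mult_mat(1) simp: mtrace_def mult_mat_index intro!: sum.cong)
  also have "\<dots> = (\<Sum>k<n. \<Sum>i<n. B $$ (k, i) * A $$ (i, k))"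
    by (subst sum.swap) (simp add: mult.commute)
  also have "\<dots> = mtrace (B * A)"
    using A B by (auto simp del: index_mult_mat(1) simp: mtrace_def mult_mat_index intro!: sum.cong)
  finally show ?thesis .
qed

lemma mtrace_similar:
  fixes A B :: "'a::comm_ring_1 mat"
  assumes "similar_mat A B"
  shows "mtrace A = mtrace B"
proof -
  obtain n P Q where w: "{A, B, P, Q} \<subseteq> carrier_mat n n" "Q * P = 1\<^sub>m n" "A = P * B * Q"
    using similar_matD[OF assms] by blast
  then have c: "B \<in> carrier_mat n n" "P \<in> carrier_mat n n" "Q \<in> carrier_mat n n" by auto
  have "mtrace A = mtrace (P * (B * Q))"
    using w c by (simp add: assoc_mult_mat[of _ n n _ n _ n])
  also have "\<dots> = mtrace (B * Q * P)"
    using c by (intro mtrace_mult_commute[of _ n]) auto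
  also have "B * Q * P = B"
    using w c by (simp add: assoc_mult_mat[of _ n n _ n _ n])
  finally show ?thesis .
qed

lemma similar_mat_map:
  assumes h: "comm_ring_hom h" and sim: "similar_mat A B"
  shows "similar_mat (map_mat h A) (map_mat h B)"
proof -
  interpret comm_ring_hom h by fact
  obtain n P Q where w: "{A, B, P, Q} \<subseteq> carrier_mat n n" "P * Q = 1\<^sub>m n" "Q * P = 1\<^sub>m n" "A = P * B * Q"
    using similar_matD[OF sim] by blast
  then have c: "B \<in> carrier_mat n n" "P \<in> carrier_mat n n" "Q \<in> carrier_mat n n" "A \<in> carrier_mat n n"
    by auto
  show ?thesis
  proof (rule similar_matI)
    show "{map_mat h A, map_mat h B, map_mat h P, map_mat h Q} \<subseteq> carrier_mat n n" using c by auto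
    show "map_mat h P * map_mat h Q = 1\<^sub>m n" "map_mat h Q * map_mat h P = 1\<^sub>m n"
      using mat_hom_mult[OF c(2,3)] mat_hom_mult[OF c(3,2)] w by (simp_all add: mat_hom_one)
    show "map_mat h A = map_mat h P * map_mat h B * map_mat h Q"
      using mat_hom_mult[OF c(2,1)] mat_hom_mult[OF mult_carrier_mat[OF c(2,1)] c(3)] w(4) by simp
  qed
qed

text \<open>Conjugation by the block permutation matrix \<open>?P\<close> with inverse
  \<open>?Q\<close>. The sizes differ in general, because a single Jordan block is moved past a
  whole list of blocks.\<close>

lemma similar_mat_block_swap:
  fixes A D :: "'a::comm_ring_1 mat"
  assumes A: "A \<in> carrier_mat n n" and D: "D \<in> carrier_mat m m"
  shows "similar_mat (four_block_mat A (0\<^sub>m n m) (0\<^sub>m m n) D) (four_block_mat D (0\<^sub>m m n) (0\<^sub>m n m) A)"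
proof (rule similar_matI)
  let ?P = "four_block_mat (0\<^sub>m n m) (1\<^sub>m n) (1\<^sub>m m) (0\<^sub>m m n) :: 'a mat"
  let ?Q = "four_block_mat (0\<^sub>m m n) (1\<^sub>m m) (1\<^sub>m n) (0\<^sub>m n m) :: 'a mat"
  show "{four_block_mat A (0\<^sub>m n m) (0\<^sub>m m n) D, four_block_mat D (0\<^sub>m m n) (0\<^sub>m n m) A, ?P, ?Q}
      \<subseteq> carrier_mat (n + m) (n + m)"
    using A D by auto
  show "?P * ?Q = 1\<^sub>m (n + m)"
    by (subst mult_four_block_mat[of _ n m _ n _ m _ _ n _ m]) auto
  show "?Q * ?P = 1\<^sub>m (n + m)"
    by (subst mult_four_block_mat[of _ m n _ m _ n _ _ m _ n]) (auto simp: add.commute)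
  show "four_block_mat A (0\<^sub>m n m) (0\<^sub>m m n) D = ?P * four_block_mat D (0\<^sub>m m n) (0\<^sub>m n m) A * ?Q"
    using A D
    by (simp add: mult_four_block_mat[of _ n m _ n _ m _ _ m _ n] mult_four_block_mat[of _ n m _ n _ m _ _ n _ m])
qed

lemma jordan_matrix_append:
  "jordan_matrix (xs @ ys) = four_block_mat (jordan_matrix xs)
     (0\<^sub>m (sum_list (map fst xs)) (sum_list (map fst ys)))
     (0\<^sub>m (sum_list (map fst ys)) (sum_list (map fst xs))) (jordan_matrix ys)"
  unfolding jordan_matrix_def map_append diag_block_mat_append Let_def
  unfolding jordan_matrix_def[symmetric] by simp

lemma similar_jordan_matrix_append:
  fixes xs :: "(nat \<times> 'a::comm_ring_1) list"
  assumes "similar_mat (jordan_matrix xs) (jordan_matrix xs')" "similar_mat (jordan_matrix ys) (jordan_matrix ys')"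
  shows "similar_mat (jordan_matrix (xs @ ys)) (jordan_matrix (xs' @ ys'))"
proof -
  have dim: "dim_row B = dim_row A" if "similar_mat A B" for A B :: "'a mat"
    using that by (auto simp: similar_mat_def similar_mat_wit_def Let_def)
  have "sum_list (map fst xs') = sum_list (map fst xs)" "sum_list (map fst ys') = sum_list (map fst ys)"
    using dim[OF assms(1)] dim[OF assms(2)] by simp_all
  then show ?thesis
    unfolding jordan_matrix_append
    using similar_mat_four_block_0_0[OF assms jordan_matrix_carrier jordan_matrix_carrier] by simp
qed

text \<open>\<open>jordan_matrix\<close> depends on the order of its list, but (iv) fixes the blocks
  only up to permutation. In the induction the head \<open>x\<close> is found in
  \<open>ys = as @ x # bs\<close> and carried across \<open>as\<close> by one block swap.\<close>

lemma similar_jordan_matrix_mset: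
  fixes xs :: "(nat \<times> 'a::comm_ring_1) list"
  assumes "mset xs = mset ys"
  shows "similar_mat (jordan_matrix xs) (jordan_matrix ys)"
  using assms
proof (induction xs arbitrary: ys)
  case Nil
  then show ?case by (simp add: similar_mat_refl[OF jordan_matrix_carrier])
next
  case (Cons x xs)
  then have "x \<in> set ys" by (metis list.set_intros(1) mset_eq_setD)
  then obtain as bs where ys: "ys = as @ x # bs" by (auto dest: split_list)
  have refl: "similar_mat (jordan_matrix zs) (jordan_matrix zs)" for zs :: "(nat \<times> 'a) list"
    by (rule similar_mat_refl[OF jordan_matrix_carrier])
  have "similar_mat (jordan_matrix ([x] @ xs)) (jordan_matrix ([x] @ (as @ bs)))"
    using Cons by (intro similar_jordan_matrix_append refl) (simp add: ys)
  moreover have "similar_mat (jordan_matrix ([x] @ as)) (jordan_matrix (as @ [x]))"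
    unfolding jordan_matrix_append by (rule similar_mat_block_swap) auto
  then have "similar_mat (jordan_matrix (([x] @ as) @ bs)) (jordan_matrix ((as @ [x]) @ bs))"
    using similar_jordan_matrix_append refl by blast
  ultimately show ?case using similar_mat_trans unfolding ys by fastforce
qed

section \<open>Complex conjugation and the real block form\<close>

lemma comm_ring_hom_cnj: "comm_ring_hom cnj"
  by unfold_locales auto

lemma comm_ring_hom_of_real: "comm_ring_hom complex_of_real"
  by unfold_locales auto

lemma map_mat_cnj_jordan_matrix:
  "map_mat cnj (jordan_matrix n_as) = jordan_matrix (map (\<lambda>(k, a). (k, cnj a)) n_as)"
proof (induction n_as)
  case Nil
  then show ?case by (auto simp: jordan_matrix_def)
next
  case (Cons x xs)
  obtain k a where x: "x = (k, a)" by force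
  have s: "sum_list (map fst (map (\<lambda>(k, a). (k, cnj a)) xs)) = sum_list (map fst xs)"
    by (induction xs) auto
  have "map_mat cnj (jordan_block k a) = jordan_block k (cnj a)"
    by (intro eq_matI) auto
  then show ?case
    unfolding x list.map prod.case jordan_matrix_Cons s Cons.IH[symmetric]
    by (subst map_four_block_mat) auto
qed

text \<open>Conjugation by the block matrix \<open>(1, 1; \<i>, -\<i>)\<close>, whose columns span the
  eigenspaces of \<open>(0, -1; 1, 0)\<close>.\<close>

lemma similar_complex_block:
  fixes A B :: "real mat"
  assumes A: "A \<in> carrier_mat n n" and B: "B \<in> carrier_mat n n"
  defines "C \<equiv> map_mat complex_of_real A + \<i> \<cdot>\<^sub>m map_mat complex_of_real B"
  shows "similar_mat (map_mat complex_of_real (four_block_mat A B (- B) A))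
    (four_block_mat C (0\<^sub>m n n) (0\<^sub>m n n) (map_mat cnj C))"
proof (rule similar_matI)
  let ?c = "map_mat complex_of_real"
  let ?I = "1\<^sub>m n :: complex mat"
  let ?P = "four_block_mat ?I ?I (\<i> \<cdot>\<^sub>m ?I) ((- \<i>) \<cdot>\<^sub>m ?I)"
  let ?Q = "four_block_mat ((1/2) \<cdot>\<^sub>m ?I) ((- \<i>/2) \<cdot>\<^sub>m ?I) ((1/2) \<cdot>\<^sub>m ?I) ((\<i>/2) \<cdot>\<^sub>m ?I)"
  have Cc: "C \<in> carrier_mat n n" using A B by (simp add: C_def)
  have D: "map_mat cnj C \<in> carrier_mat n n" using Cc by simp
  show "{?c (four_block_mat A B (- B) A), four_block_mat C (0\<^sub>m n n) (0\<^sub>m n n) (map_mat cnj C), ?P, ?Q}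
      \<subseteq> carrier_mat (n + n) (n + n)"
    using A B Cc by auto
  show "?P * ?Q = 1\<^sub>m (n + n)"
    by (subst mult_four_block_mat[of _ n n _ n _ n _ _ n _ n]) 
      (auto intro!: eq_matI simp: field_simps)
  show "?Q * ?P = 1\<^sub>m (n + n)"
    by (subst mult_four_block_mat[of _ n n _ n _ n _ _ n _ n]) 
      (auto intro!: eq_matI simp: field_simps)
  have sm: "(k \<cdot>\<^sub>m ?I) * X = k \<cdot>\<^sub>m X" "X * (k \<cdot>\<^sub>m ?I) = k \<cdot>\<^sub>m X" if "X \<in> carrier_mat n n" for k X
    using that by (simp_all add: mult_smult_assoc_mat[of _ n n] mult_smult_distrib[of _ n n _ n])
  have "?P * four_block_mat C (0\<^sub>m n n) (0\<^sub>m n n) (map_mat cnj C) * ?Q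
      = four_block_mat C (map_mat cnj C) (\<i> \<cdot>\<^sub>m C) ((- \<i>) \<cdot>\<^sub>m map_mat cnj C) * ?Q"
    using Cc D by (subst mult_four_block_mat[of _ n n _ n _ n _ _ n _ n]) (auto simp: sm left_add_zero_mat[of _ n n])
  also have "\<dots> = four_block_mat ((1/2) \<cdot>\<^sub>m C + (1/2) \<cdot>\<^sub>m map_mat cnj C)
      ((- \<i>/2) \<cdot>\<^sub>m C + (\<i>/2) \<cdot>\<^sub>m map_mat cnj C)
      ((1/2) \<cdot>\<^sub>m (\<i> \<cdot>\<^sub>m C) + (1/2) \<cdot>\<^sub>m ((- \<i>) \<cdot>\<^sub>m map_mat cnj C))
      ((- \<i>/2) \<cdot>\<^sub>m (\<i> \<cdot>\<^sub>m C) + (\<i>/2) \<cdot>\<^sub>m ((- \<i>) \<cdot>\<^sub>m map_mat cnj C))"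
    using Cc D by (subst mult_four_block_mat[of _ n n _ n _ n _ _ n _ n]) (auto simp: sm)
  also have "\<dots> = ?c (four_block_mat A B (- B) A)"
    using A B by (subst map_four_block_mat[of _ n n _ n _ n])
      (auto simp: C_def complex_eq_iff intro!: arg_cong4[where f = four_block_mat] eq_matI)
  finally show "?c (four_block_mat A B (- B) A)
      = ?P * four_block_mat C (0\<^sub>m n n) (0\<^sub>m n n) (map_mat cnj C) * ?Q" ..
qed

text \<open>The trace of \<open>C = A + \<i> B\<close> has the traces of \<open>A\<close> and
  \<open>B\<close> as its real and imaginary parts, so one complex condition matches two real ones.
  A Jordan form of \<open>C\<close>, followed by its conjugate, is a Jordan form of the block
  matrix.\<close>

lemma complex_block_iff_jordan:
  fixes u :: "'a::euclidean_space set"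
  assumes u: "subspace u" "dim u = 6" and T: "linear T" "\<And>x. x \<in> u \<Longrightarrow> T x \<in> u"
  shows "(\<exists>A B b. A \<in> carrier_mat 3 3 \<and> B \<in> carrier_mat 3 3 \<and> mtrace A = 0 \<and> mtrace B = 0 \<and>
      ordered_basis 6 u b \<and> is_matrix_wrt 6 b T (four_block_mat A B (- B) A)) \<longleftrightarrow>
    (\<forall>b M. ordered_basis 6 u b \<longrightarrow> is_matrix_wrt 6 b T M \<longrightarrow>
      (\<exists>n_as :: (nat \<times> complex) list.
         0 \<notin> fst ` set n_as \<and> jordan_matrix n_as \<in> carrier_mat 3 3 \<and> mtrace (jordan_matrix n_as) = 0 \<and>
         (\<exists>m_as. mset m_as = mset (n_as @ map (\<lambda>(k, a). (k, cnj a)) n_as) \<and>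
            jordan_nf (map_mat complex_of_real M) m_as)))" (is "?L \<longleftrightarrow> ?R")
proof
  assume ?L
  then obtain A B b where A: "A \<in> carrier_mat 3 3" "mtrace A = 0" and B: "B \<in> carrier_mat 3 3" "mtrace B = 0"
    and b: "ordered_basis 6 u b" "is_matrix_wrt 6 b T (four_block_mat A B (- B) A)"
    by blast
  define C where "C = map_mat complex_of_real A + \<i> \<cdot>\<^sub>m map_mat complex_of_real B"
  have C: "C \<in> carrier_mat 3 3" using A B by (simp add: C_def)
  obtain as where "char_poly C = (\<Prod>a\<leftarrow>as. [:- a, 1:])"
    using char_poly_factorized[OF C] by blast
  then obtain n_as where "jordan_nf C n_as"
    using jordan_nf_exists[OF C] by blast
  then have n_as: "0 \<notin> fst ` set n_as" and CJ: "similar_mat C (jordan_matrix n_as)"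
    by (auto simp: jordan_nf_def)
  define J where "J = jordan_matrix n_as"
  have J: "J \<in> carrier_mat 3 3"
    using CJ C by (auto simp: J_def similar_mat_def similar_mat_wit_def Let_def)
  then have s3: "sum_list (map fst n_as) = 3"
    by (auto simp: J_def)
  let ?cn = "map (\<lambda>(k, a). (k, cnj a)) n_as"
  have s3': "sum_list (map fst ?cn) = 3"
    using s3 by (simp add: comp_def case_prod_beta)
  have "mtrace C = complex_of_real (mtrace A) + \<i> * complex_of_real (mtrace B)"
    using A(1) B(1) by (simp add: C_def mtrace_def sum.distrib sum_distrib_left)
  then have trJ: "mtrace (jordan_matrix n_as) = 0"
    using mtrace_similar[OF CJ] A B by simp
  have "similar_mat (map_mat cnj C) (jordan_matrix ?cn)"
    using similar_mat_map[OF comm_ring_hom_cnj CJ] by (simp add: map_mat_cnj_jordan_matrix)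
  then have "similar_mat (four_block_mat C (0\<^sub>m 3 3) (0\<^sub>m 3 3) (map_mat cnj C)) (jordan_matrix (n_as @ ?cn))"
    unfolding jordan_matrix_append s3 s3'
    using CJ C by (intro similar_mat_four_block_0_0) auto
  then have N: "similar_mat (map_mat complex_of_real (four_block_mat A B (- B) A)) (jordan_matrix (n_as @ ?cn))"
    using similar_complex_block[OF A(1) B(1)] similar_mat_trans unfolding C_def by blast
  show ?R
  proof (intro allI impI)
    fix b' M assume b': "ordered_basis 6 u b'" "is_matrix_wrt 6 b' T M"
    have "similar_mat (map_mat complex_of_real M) (map_mat complex_of_real (four_block_mat A B (- B) A))"
      by (rule similar_mat_map[OF comm_ring_hom_of_real matrices_wrt_similar[OF b' T(1) b]])
    then have "similar_mat (map_mat complex_of_real M) (jordan_matrix (n_as @ ?cn))"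
      using N similar_mat_trans by blast
    moreover have "0 \<notin> fst ` set (n_as @ ?cn)"
      using n_as by force
    ultimately have "jordan_nf (map_mat complex_of_real M) (n_as @ ?cn)"
      by (simp add: jordan_nf_def)
    then show "\<exists>n_as :: (nat \<times> complex) list.
         0 \<notin> fst ` set n_as \<and> jordan_matrix n_as \<in> carrier_mat 3 3 \<and> mtrace (jordan_matrix n_as) = 0 \<and>
         (\<exists>m_as. mset m_as = mset (n_as @ map (\<lambda>(k, a). (k, cnj a)) n_as) \<and>
            jordan_nf (map_mat complex_of_real M) m_as)"
      using n_as J trJ unfolding J_def by blast
  qed
next
  assume R: ?R
  obtain b where b: "ordered_basis 6 u b" using ordered_basis_exists[OF u] by blast
  obtain M where M: "is_matrix_wrt 6 b T M" using matrix_wrt_exists[OF b, of T] T(2) by blast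
  obtain n_as :: "(nat \<times> complex) list" and m_as where J: "jordan_matrix n_as \<in> carrier_mat 3 3"
    and tr: "mtrace (jordan_matrix n_as) = 0"
    and ms: "mset m_as = mset (n_as @ map (\<lambda>(k, a). (k, cnj a)) n_as)"
    and nf: "jordan_nf (map_mat complex_of_real M) m_as"
    using R b M by blast
  let ?cn = "map (\<lambda>(k, a). (k, cnj a)) n_as"
  have s3: "sum_list (map fst n_as) = 3"
    using J by auto
  have s3': "sum_list (map fst ?cn) = 3"
    using s3 by (simp add: comp_def case_prod_beta)
  \<comment> \<open>The Jordan matrix itself plays the part of \<open>A + \<i> B\<close>; the
    resulting real block matrix is complex similar, hence real similar, to \<open>M\<close>.\<close>
  define A where "A = map_mat Re (jordan_matrix n_as)"
  define B where "B = map_mat Im (jordan_matrix n_as)"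
  have A: "A \<in> carrier_mat 3 3" and B: "B \<in> carrier_mat 3 3" using J by (simp_all add: A_def B_def)
  have C: "map_mat complex_of_real A + \<i> \<cdot>\<^sub>m map_mat complex_of_real B = jordan_matrix n_as"
    by (intro eq_matI) (auto simp: A_def B_def complex_eq_iff)
  have "mtrace A = Re (mtrace (jordan_matrix n_as))" "mtrace B = Im (mtrace (jordan_matrix n_as))"
    by (simp_all add: A_def B_def mtrace_def)
  then have trs: "mtrace A = 0" "mtrace B = 0" using tr by simp_all
  let ?N = "four_block_mat A B (- B) A"
  have "similar_mat (map_mat complex_of_real M) (jordan_matrix m_as)"
    using nf by (simp add: jordan_nf_def)
  moreover have "similar_mat (jordan_matrix m_as) (jordan_matrix (n_as @ ?cn))"
    by (rule similar_jordan_matrix_mset[OF ms])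
  moreover have "similar_mat (map_mat complex_of_real ?N) (jordan_matrix (n_as @ ?cn))"
    using similar_complex_block[OF A B]
    unfolding C jordan_matrix_append s3 s3' map_mat_cnj_jordan_matrix .
  ultimately have sim: "similar_mat (map_mat complex_of_real M) (map_mat complex_of_real ?N)"
    using similar_mat_trans similar_mat_sym by blast
  have Mc: "M \<in> carrier_mat 6 6" using M by (simp add: is_matrix_wrt_def)
  have Nc: "?N \<in> carrier_mat 6 6" using four_block_carrier_mat[OF A A, of B "- B"] by simp
  obtain R S where RS: "R \<in> carrier_mat 6 6" "S \<in> carrier_mat 6 6" "S * R = 1\<^sub>m 6" "M * R = R * ?N"
    using complex_similar_imp_real_similar[OF Mc Nc sim] by blast
  obtain b' where "ordered_basis 6 u b'" "is_matrix_wrt 6 b' T ?N"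
    using matrix_change_of_basis[OF b M T(1) RS(1-3) Nc RS(4)] by blast
  then show ?L using A B trs by blast
qed

section \<open>Hyperplanes and signatures\<close>

lemma dim_linear_image:
  fixes f :: "'a::euclidean_space \<Rightarrow> 'b::euclidean_space"
  assumes "linear f" "inj f"
  shows "dim (f ` S) = dim S"
  using assms by (intro dim_image_eq) (auto intro: inj_on_subset)

lemma hyperplane_decomposition:
  fixes u :: "'a::euclidean_space set"
  assumes u: "subspace u" "dim u + 1 = DIM('a)" and v: "v \<notin> u"
  shows "\<exists>y\<in>u. \<exists>t. x = y + t *\<^sub>R v"
proof -
  have "dim (insert v u) = DIM('a)"
    using u v by (simp add: dim_insert span_eq_iff[THEN iffD2])
  then have "x \<in> span (insert v u)"
    by (simp add: dim_eq_full)
  then obtain k where "x - k *\<^sub>R v \<in> u"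
    using u(1) by (auto simp: span_insert span_eq_iff[THEN iffD2])
  then show ?thesis by (intro bexI[of _ "x - k *\<^sub>R v"] exI[of _ k]) auto
qed

lemma hyperplane_normal:
  fixes H :: "(real^7) set"
  assumes e: "\<epsilon> = 1 \<or> \<epsilon> = -1" and H: "subspace H" "dim H = 6"
  obtains n where "n \<noteq> 0" "H = {x. ip \<epsilon> n x = 0}"
proof -
  have "dim H < DIM(real^7)" using H by simp
  then obtain a where a: "a \<noteq> 0" "span H \<subseteq> {x. a \<bullet> x = 0}"
    using lowdim_subset_hyperplane by blast
  have "H = {x. a \<bullet> x = 0}"
    using a H by (intro subspace_dim_equal) (auto simp: span_eq_iff[THEN iffD2] subspace_hyperplane dim_hyperplane)
  \<comment> \<open>The Euclidean normal \<open>a\<close> becomes a normal for \<open>ip\<close> by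
    raising its index with the diagonal signs; this uses
    \<open>\<epsilon> * \<epsilon> = 1\<close>.\<close>
  moreover define n where "n = (\<chi> i. (if i \<in> {1, 2, 3, 4} then - \<epsilon> else 1) * a $ i)"
  have "ip \<epsilon> n x = a \<bullet> x" for x
    using e by (auto simp: ip_def n_def inner_vec_def sum_7 algebra_simps)
  moreover from this[of a] have "n \<noteq> 0"
    using a(1) by (auto simp: ip_def)
  ultimately show ?thesis using that by auto
qed

lemma dim_coordinate_subspace:
  "subspace {x::real^7. \<forall>i. i \<notin> d \<longrightarrow> x $ i = 0}" "dim {x::real^7. \<forall>i. i \<notin> d \<longrightarrow> x $ i = 0} = card d"
  using subspace_substandard_cart[of "\<lambda>i. i \<notin> d", where 'a = real] dim_substandard_cart[of d, where 'a = real]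
  unfolding Cartesian_Space.dim_vec_eq Cartesian_Space.subspace_vec_eq by simp_all

lemma dim_disjoint_subspaces:
  fixes S T H :: "'a::euclidean_space set"
  assumes S: "subspace S" "S \<subseteq> H" and T: "subspace T" "T \<subseteq> H" and H: "subspace H"
    and ST: "\<And>x. x \<in> S \<Longrightarrow> x \<in> T \<Longrightarrow> x = 0"
  shows "dim S + dim T \<le> dim H"
proof -
  have "S \<inter> T = {0}"
    using ST subspace_0[OF S(1)] subspace_0[OF T(1)] by blast
  then have "dim {x + y |x y. x \<in> S \<and> y \<in> T} = dim S + dim T"
    using dim_sums_Int[OF S(1) T(1)] by simp
  moreover have "{x + y |x y. x \<in> S \<and> y \<in> T} \<subseteq> H"
    using S(2) T(2) subspace_add[OF H] by blast
  then have "dim {x + y |x y. x \<in> S \<and> y \<in> T} \<le> dim H"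
    by (rule dim_subset)
  ultimately show ?thesis by simp
qed

section \<open>Definite subspaces of maximal dimension\<close>

lemma Max_dim_mem:
  fixes P :: "'a::euclidean_space set \<Rightarrow> bool"
  assumes "P {0}"
  shows "Max {dim W | W. P W} \<in> {dim W | W. P W}"
proof (rule Max_in)
  show "finite {dim W | W. P W}"
    by (rule finite_subset[of _ "{..DIM('a)}"]) (use dim_subset_UNIV in blast, simp)
  show "{dim W | W. P W} \<noteq> {}" using assms by blast
qed

lemma neg_index_witness:
  fixes u :: "'a::euclidean_space set"
  assumes "subspace u"
  obtains W where "subspace W" "W \<subseteq> u" "\<And>w. w \<in> W \<Longrightarrow> w \<noteq> 0 \<Longrightarrow> g w w < 0" "dim W = neg_index g u"
proof -
  let ?P = "\<lambda>W. subspace W \<and> W \<subseteq> u \<and> (\<forall>w\<in>W. w \<noteq> 0 \<longrightarrow> g w w < 0)"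
  have "?P {0}" using assms by (simp add: subspace_0 subspace_single_0)
  then have "neg_index g u \<in> {dim W | W. ?P W}"
    unfolding neg_index_def by (rule Max_dim_mem)
  then obtain W where "neg_index g u = dim W" "?P W" by blast
  then show ?thesis by (intro that[of W]) simp_all
qed

lemma ip_1_definite:
  assumes "x \<noteq> 0"
  shows "\<forall>i. i \<notin> {1, 2, 3, 4} \<longrightarrow> x $ i = 0 \<Longrightarrow> ip 1 x x < 0"
    and "\<forall>i. i \<notin> {5, 6, 7} \<longrightarrow> x $ i = 0 \<Longrightarrow> ip 1 x x > 0"
proof -
  have nz: "\<not> (x$1 = 0 \<and> x$2 = 0 \<and> x$3 = 0 \<and> x$4 = 0 \<and> x$5 = 0 \<and> x$6 = 0 \<and> x$7 = 0)"
    using assms by (simp add: vec7_eq_iff)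
  have sq: "x$i * x$i \<ge> 0" "x$i \<noteq> 0 \<Longrightarrow> x$i * x$i > 0" for i
    by (simp, metis not_real_square_gt_zero)
  show "ip 1 x x < 0" if "\<forall>i. i \<notin> {1, 2, 3, 4} \<longrightarrow> x $ i = 0"
  proof -
    have z: "x$5 = 0" "x$6 = 0" "x$7 = 0" using that by auto
    then have "x$1 \<noteq> 0 \<or> x$2 \<noteq> 0 \<or> x$3 \<noteq> 0 \<or> x$4 \<noteq> 0" using nz by blast
    then have "x$1 * x$1 + x$2 * x$2 + x$3 * x$3 + x$4 * x$4 > 0"
      using sq(2)[of 1] sq(2)[of 2] sq(2)[of 3] sq(2)[of 4] sq(1)[of 1] sq(1)[of 2] sq(1)[of 3] sq(1)[of 4]
      by argo
    then show ?thesis by (simp add: ip_def z)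
  qed
  show "ip 1 x x > 0" if "\<forall>i. i \<notin> {5, 6, 7} \<longrightarrow> x $ i = 0"
  proof -
    have z: "x$1 = 0" "x$2 = 0" "x$3 = 0" "x$4 = 0" using that by auto
    then have "x$5 \<noteq> 0 \<or> x$6 \<noteq> 0 \<or> x$7 \<noteq> 0" using nz by blast
    then have "x$5 * x$5 + x$6 * x$6 + x$7 * x$7 > 0"
      using sq(2)[of 5] sq(2)[of 6] sq(2)[of 7] sq(1)[of 5] sq(1)[of 6] sq(1)[of 7] by argo
    then show ?thesis by (simp add: ip_def z)
  qed
qed

text \<open>Otherwise a four-dimensional negative subspace of the hyperplane and \<open>n\<close> together
  span a negative semidefinite subspace of dimension five.\<close>

lemma normal_positive:
  assumes n: "n \<noteq> 0" and W: "subspace W" "dim W = 4" "\<And>x. x \<in> W \<Longrightarrow> ip 1 n x = 0"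
    and neg: "\<And>x. x \<in> W \<Longrightarrow> x \<noteq> 0 \<Longrightarrow> ip 1 x x < 0"
  shows "ip 1 n n > 0"
proof (rule ccontr)
  assume nn: "\<not> ip 1 n n > 0"
  let ?V = "span (insert n W)"
  \<comment> \<open>The positive definite coordinate space, of dimension 3. It meets the negative
    semidefinite \<open>?V\<close> trivially, yet 5 + 3 exceeds 7.\<close>
  let ?P = "{x::real^7. \<forall>i. i \<notin> {5, 6, 7} \<longrightarrow> x $ i = 0}"
  \<comment> \<open>A vector of \<open>W\<close> is orthogonal to \<open>n\<close>, so
    \<open>n\<close> in \<open>W\<close> would be null, against negativity on
    \<open>W\<close>.\<close>
  have "n \<notin> W" using neg[of n] W(3)[of n] n by auto
  then have "dim ?V = 5"
    using W by (simp add: dim_insert span_eq_iff[THEN iffD2])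
  have le: "ip 1 x x \<le> 0" if "x \<in> ?V" for x
  proof -
    obtain k where k: "x - k *\<^sub>R n \<in> W"
      using \<open>x \<in> ?V\<close> W(1) by (auto simp: span_insert span_eq_iff[THEN iffD2])
    define y where "y = x - k *\<^sub>R n"
    have y: "y \<in> W" and x: "x = y + k *\<^sub>R n" using k by (auto simp: y_def)
    have "ip 1 x x = ip 1 y y + 2 * k * ip 1 n y + k * k * ip 1 n n"
      unfolding x by (simp add: ip_def algebra_simps)
    moreover have "ip 1 y y \<le> 0"
      using neg[OF y] by (cases "y = 0") (auto simp: ip_def)
    moreover have "k * k * ip 1 n n \<le> 0"
      using nn by (simp add: mult_nonneg_nonpos)
    ultimately show ?thesis using W(3)[OF y] by simp
  qed
  have "dim ?V + dim ?P \<le> dim (UNIV :: (real^7) set)"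
  proof (rule dim_disjoint_subspaces)
    fix x assume "x \<in> ?V" "x \<in> ?P"
    then show "x = 0" using le[of x] ip_1_definite(2)[of x] by force
  qed (use dim_coordinate_subspace(1)[of "{5, 6, 7}"] in auto)
  then show False using \<open>dim ?V = 5\<close> dim_coordinate_subspace(2)[of "{5, 6, 7}"] by simp
qed

text \<open>The coordinate spaces {5,6} and {1,2,3,4} realise the two indices. They also bound each
  other: a positive subspace meets the negative one trivially inside six dimensions, and vice
  versa.\<close>

lemma signature_ip:
  fixes f :: "'a::euclidean_space \<Rightarrow> real^7"
  assumes f: "linear f" "bij f" and u: "u = {x. f x $ 7 = 0}"
  shows "signature (\<lambda>v w. ip 1 (f v) (f w)) u = (2, 4)"
proof -
  let ?C = "\<lambda>d. {x::real^7. \<forall>i. i \<notin> d \<longrightarrow> x $ i = 0}"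
  have inj: "inj f" and surj: "surj f" using f by (auto simp: bij_def)
  have f0: "f x = 0 \<longleftrightarrow> x = 0" for x
    using linear_injective_0[OF f(1)] inj linear_0[OF f(1)] by auto
  have fu: "f ` W \<subseteq> ?C {1, 2, 3, 4, 5, 6}" if "W \<subseteq> u" for W
  proof
    fix y assume "y \<in> f ` W"
    then have y: "y $ 7 = 0" using that u by auto
    have "y $ i = 0" if "i \<notin> {1, 2, 3, 4, 5, 6}" for i
      using exhaust_7[of i] that y by (elim disjE) simp_all
    then show "y \<in> ?C {1, 2, 3, 4, 5, 6}" by blast
  qed
  have img: "f ` (f -` S) = S" for S using surj by (rule surj_image_vimage_eq)
  have cC: "card {1, 2, 3, 4, 5, 6::7} = 6" "card {1, 2, 3, 4::7} = 4" "card {5, 6::7} = 2" by simp_all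
  have vim: "subspace (f -` ?C d)" "dim (f -` ?C d) = card d" for d
    using linear_subspace_vimage[OF f(1) dim_coordinate_subspace(1)[of d]] dim_coordinate_subspace(2)[of d]
      dim_linear_image[OF f(1) inj, of "f -` ?C d"] unfolding img by simp_all
  have vimu: "f -` ?C d \<subseteq> u" if "7 \<notin> d" for d
    unfolding u using that by (auto simp: vimage_def)
  have bound: "dim W + card d \<le> 6"
    if W: "subspace W" "W \<subseteq> u" and d: "d \<subseteq> {1, 2, 3, 4, 5, 6}"
      and disj: "\<And>x. x \<in> W \<Longrightarrow> f x \<in> ?C d \<Longrightarrow> x = 0" for W d
  proof -
    have "dim (f ` W) + dim (?C d) \<le> dim (?C {1, 2, 3, 4, 5, 6})"
    proof (rule dim_disjoint_subspaces)
      show "x = 0" if "x \<in> f ` W" "x \<in> ?C d" for x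
        using that disj linear_0[OF f(1)] by blast
      show "subspace (f ` W)" using linear_subspace_image[OF f(1) W(1)] .
      show "f ` W \<subseteq> ?C {1, 2, 3, 4, 5, 6}" by (rule fu[OF W(2)])
      show "?C d \<subseteq> ?C {1, 2, 3, 4, 5, 6}" using d by blast
    qed (rule dim_coordinate_subspace(1))+
    then show ?thesis
      unfolding dim_linear_image[OF f(1) inj] dim_coordinate_subspace(2) cC(1) .
  qed
  have fin: "finite {dim W | W. P W}" for P :: "'a set \<Rightarrow> bool"
    by (rule finite_subset[of _ "{..DIM('a)}"]) (use dim_subset_UNIV in blast, simp)
  have "pos_index (\<lambda>v w. ip 1 (f v) (f w)) u = 2"
    unfolding pos_index_def
  proof (rule Max_eqI[OF fin])
    show "y \<le> 2" if y: "y \<in> {dim W |W. subspace W \<and> W \<subseteq> u \<and> (\<forall>w\<in>W. w \<noteq> 0 \<longrightarrow> 0 < ip 1 (f w) (f w))}" for y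
    proof -
      obtain W where W: "y = dim W" "subspace W" "W \<subseteq> u" "\<forall>w\<in>W. w \<noteq> 0 \<longrightarrow> 0 < ip 1 (f w) (f w)"
        using y by blast
      have "dim W + card {1, 2, 3, 4::7} \<le> 6"
      proof (rule bound[OF W(2,3)])
        fix x assume "x \<in> W" "f x \<in> ?C {1, 2, 3, 4}"
        then show "x = 0"
          using W(4) ip_1_definite(1)[of "f x"] f0[of x] by (metis (mono_tags, lifting) mem_Collect_eq not_less_iff_gr_or_eq)
      qed simp
      then show ?thesis using W(1) cC by simp
    qed
    have "ip 1 (f w) (f w) > 0" if "w \<in> f -` ?C {5, 6}" "w \<noteq> 0" for w
      using that f0[of w] by (intro ip_1_definite(2)) auto
    then show "2 \<in> {dim W |W. subspace W \<and> W \<subseteq> u \<and> (\<forall>w\<in>W. w \<noteq> 0 \<longrightarrow> 0 < ip 1 (f w) (f w))}"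
      using vim[of "{5, 6}"] vimu[of "{5, 6}"] cC(3)
      by (intro CollectI exI[of _ "f -` ?C {5, 6}"] conjI ballI impI) simp_all
  qed
  moreover have "neg_index (\<lambda>v w. ip 1 (f v) (f w)) u = 4"
    unfolding neg_index_def
  proof (rule Max_eqI[OF fin])
    show "y \<le> 4" if y: "y \<in> {dim W |W. subspace W \<and> W \<subseteq> u \<and> (\<forall>w\<in>W. w \<noteq> 0 \<longrightarrow> ip 1 (f w) (f w) < 0)}" for y
    proof -
      obtain W where W: "y = dim W" "subspace W" "W \<subseteq> u" "\<forall>w\<in>W. w \<noteq> 0 \<longrightarrow> ip 1 (f w) (f w) < 0"
        using y by blast
      have "dim W + card {5, 6::7} \<le> 6"
      proof (rule bound[OF W(2,3)])
        fix x assume x: "x \<in> W" "f x \<in> ?C {5, 6}"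
        then have "\<forall>i. i \<notin> {5, 6, 7} \<longrightarrow> f x $ i = 0" by blast
        then show "x = 0"
          using x(1) W(4) ip_1_definite(2)[of "f x"] f0[of x] by (metis not_less_iff_gr_or_eq)
      qed simp
      then show ?thesis using W(1) cC by simp
    qed
    have "ip 1 (f w) (f w) < 0" if "w \<in> f -` ?C {1, 2, 3, 4}" "w \<noteq> 0" for w
      using that f0[of w] by (intro ip_1_definite(1)) auto
    then show "4 \<in> {dim W |W. subspace W \<and> W \<subseteq> u \<and> (\<forall>w\<in>W. w \<noteq> 0 \<longrightarrow> ip 1 (f w) (f w) < 0)}"
      using vim[of "{1, 2, 3, 4}"] vimu[of "{1, 2, 3, 4}"] cC(2)
      by (intro CollectI exI[of _ "f -` ?C {1, 2, 3, 4}"] conjI ballI impI) simp_all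
  qed
  ultimately show ?thesis by (simp add: signature_def)
qed

section \<open>Calibrated structures on almost Abelian Lie algebras\<close>

lemma alternating3_tri:
  fixes f :: "'a::euclidean_space \<Rightarrow> real^7"
  assumes "linear f"
  shows "alternating3 (\<lambda>x y z. tri \<epsilon> (f x) (f y) (f z))"
proof (rule alternating3.intro)
  show "tri \<epsilon> (f y) (f x) (f z) = - tri \<epsilon> (f x) (f y) (f z)" for x y z by (rule tri_swap12)
  show "tri \<epsilon> (f x) (f z) (f y) = - tri \<epsilon> (f x) (f y) (f z)" for x y z by (rule tri_swap23)
  show "linear (\<lambda>x. tri \<epsilon> (f x) (f y) (f z))" for y z
    by (rule linearI) (simp_all add: linear_add[OF assms] linear_scale[OF assms] tri_add1 tri_scale1)
qed

text \<open>Common to both signs of \<epsilon>. The two applications differ only in how they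
  establish that the normal is spacelike.\<close>

lemma calibrated_imp_complex_block:
  fixes br :: "'a::euclidean_space \<Rightarrow> 'a \<Rightarrow> 'a"
  assumes dims: "DIM('a) = 7" "dim u = 6" and br: "lie_algebra br" and u: "abelian_ideal br u" and f7: "f7 \<notin> u"
    and e: "\<epsilon> = 1 \<or> \<epsilon> = -1" and f: "adapted_iso \<epsilon> \<phi> f" and cal: "calibrated br \<phi>"
    and n: "f ` u = {x. ip \<epsilon> n x = 0}" "ip \<epsilon> n n > 0"
  shows "\<exists>A B b. A \<in> carrier_mat 3 3 \<and> B \<in> carrier_mat 3 3 \<and> mtrace A = 0 \<and> mtrace B = 0 \<and>
    ordered_basis 6 u b \<and> is_matrix_wrt 6 b (br f7) (four_block_mat A B (- B) A)"
proof -
  have lf: "linear f" and bf: "bij f" and \<phi>: "\<phi> = (\<lambda>x. tri \<epsilon> (f (x 0)) (f (x 1)) (f (x 2)))"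
    using f by (auto simp: adapted_iso_def phi_eps_eq_tri)
  interpret alternating3 "\<lambda>x y z. tri \<epsilon> (f x) (f y) (f z)"
    using lf by (rule alternating3_tri)
  have su: "subspace u" using u by (simp add: abelian_ideal_def)
  define f' where "f' = inv_into UNIV f"
  have ff': "f (f' x) = x" for x using bf by (simp add: f'_def bij_is_surj surj_f_inv_f)
  have f'f: "f' (f x) = x" for x using bf by (simp add: f'_def bij_is_inj)
  have eqI: "x = y" if "f x = f y" for x y using that f'f by metis
  have lf': "linear f'"
    by (rule linearI; rule eqI) (simp_all add: linear_add[OF lf] linear_scale[OF lf] ff')
  have mem: "x \<in> u \<longleftrightarrow> ip \<epsilon> n (f x) = 0" for x
    using n(1) f'f by (metis (mono_tags, lifting) image_iff mem_Collect_eq)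
  \<comment> \<open>Normalises the cross product so that its square on \<open>u\<close> becomes
    minus the identity; positivity of \<open>ip \<epsilon> n n\<close> makes the square root
    usable.\<close>
  define c where "c = 1 / sqrt (ip \<epsilon> n n)"
  have c: "c * c * ip \<epsilon> n n = 1" using n(2) by (simp add: c_def field_simps)
  define J where "J x = f' (c *\<^sub>R cross7 \<epsilon> n (f x))" for x
  have fJ: "f (J x) = c *\<^sub>R cross7 \<epsilon> n (f x)" for x by (simp add: J_def ff')
  have lJ: "linear J"
    by (rule linearI) (simp_all add: J_def linear_add[OF lf] linear_scale[OF lf] linear_add[OF lf'] linear_scale[OF lf']
        linear_add[OF linear_cross7] linear_scale[OF linear_cross7] algebra_simps)
  have Ju: "J x \<in> u" for x
  proof -
    have "tri \<epsilon> n (f x) n = 0" using tri_swap12[of \<epsilon> n n "f x"] tri_swap23[of \<epsilon> n n "f x"] by simp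
    then show ?thesis
      unfolding mem fJ by (simp add: linear_scale[OF linear_ip] ip_commute[of \<epsilon> n] ip_cross7[OF e])
  qed
  have JJ: "J (J x) = - x" if "x \<in> u" for x
  proof (rule eqI)
    have "f (J (J x)) = - ((c * c * ip \<epsilon> n n) *\<^sub>R f x)"
      using that by (simp add: fJ linear_scale[OF linear_cross7] cross7_cross7[OF e] mem mult.assoc)
    then show "f (J (J x)) = f (- x)" unfolding c by (simp add: linear_neg[OF lf])
  qed
  have FJ: "tri \<epsilon> (f (J x)) (f y) (f z) = tri \<epsilon> (f x) (f (J y)) (f z)"
    if "x \<in> u" "y \<in> u" "z \<in> u" for x y z
  proof -
    have "tri \<epsilon> (f x) (c *\<^sub>R cross7 \<epsilon> n (f y)) (f z) = c * tri \<epsilon> (f x) (cross7 \<epsilon> n (f y)) (f z)"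
      using tri_scaleR3[of \<epsilon> 1 "f x" c _ 1 "f z"] by simp
    then show ?thesis
      using tri_cross7_swap[OF e, of n "f x" "f y" "f z"] that by (simp add: fJ tri_scale1 mem)
  qed
  have lT: "linear (br f7)" using br by (simp add: lie_algebra_def)
  have Tu: "br f7 x \<in> u" if "x \<in> u" for x using u that by (simp add: abelian_ideal_def)
  have "dim u + 1 = DIM('a)" using dims by simp
  from calibrated_iff[OF br u hyperplane_decomposition[OF su this f7]] cal
  have der: "tri \<epsilon> (f (br f7 x)) (f y) (f z) + tri \<epsilon> (f x) (f (br f7 y)) (f z) + tri \<epsilon> (f x) (f y) (f (br f7 z)) = 0"
    if "x \<in> u" "y \<in> u" "z \<in> u" for x y z
    using that unfolding \<phi> by blast
  obtain x y z where xyz: "ip \<epsilon> n x = 0" "ip \<epsilon> n y = 0" "ip \<epsilon> n z = 0" "tri \<epsilon> x y z \<noteq> 0"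
    using tri_nonzero_on_hyperplane[OF e, of n] n(2) by auto
  show ?thesis
    by (rule complex_structure_matrix[OF su dims(2) lJ Ju JJ FJ lT Tu der, of "f' x" "f' y" "f' z"])
      (use xyz in \<open>simp_all add: mem ff'\<close>)
qed

lemma G2_imp_complex_block:
  fixes br :: "'a::euclidean_space \<Rightarrow> 'a \<Rightarrow> 'a"
  assumes dims: "DIM('a) = 7" "dim u = 6" and br: "lie_algebra br" and u: "abelian_ideal br u" and f7: "f7 \<notin> u"
    and \<phi>: "G2_structure (-1) \<phi>" "calibrated br \<phi>"
  shows "\<exists>A B b. A \<in> carrier_mat 3 3 \<and> B \<in> carrier_mat 3 3 \<and> mtrace A = 0 \<and> mtrace B = 0 \<and>
    ordered_basis 6 u b \<and> is_matrix_wrt 6 b (br f7) (four_block_mat A B (- B) A)"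
proof -
  obtain f where f: "adapted_iso (-1) \<phi> f" using \<phi> by (auto simp: G2_structure_def)
  then have lf: "linear f" and inj: "inj f" by (auto simp: adapted_iso_def bij_is_inj)
  have su: "subspace u" using u by (simp add: abelian_ideal_def)
  obtain n where n: "n \<noteq> 0" "f ` u = {x. ip (-1) n x = 0}"
    using hyperplane_normal[of "-1" "f ` u"] dim_linear_image[OF lf inj] dims linear_subspace_image[OF lf su]
    by auto
  have "ip (-1) n n = n \<bullet> n"
    by (simp add: ip_def inner_vec_def sum_7)
  then have "ip (-1) n n > 0" using n(1) by simp
  then show ?thesis
    using calibrated_imp_complex_block[OF dims br u f7 _ f \<phi>(2) n(2)] by simp
qed

lemma G2_star_imp_complex_block:
  fixes br :: "'a::euclidean_space \<Rightarrow> 'a \<Rightarrow> 'a"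
  assumes dims: "DIM('a) = 7" "dim u = 6" and br: "lie_algebra br" and u: "abelian_ideal br u" and f7: "f7 \<notin> u"
    and \<phi>: "calibrated br \<phi>" "G2_metric 1 \<phi> g" "signature g u = (2, 4)"
  shows "\<exists>A B b. A \<in> carrier_mat 3 3 \<and> B \<in> carrier_mat 3 3 \<and> mtrace A = 0 \<and> mtrace B = 0 \<and>
    ordered_basis 6 u b \<and> is_matrix_wrt 6 b (br f7) (four_block_mat A B (- B) A)"
proof -
  obtain f s where f: "adapted_iso 1 \<phi> f" and s: "s > 0" and g: "\<And>v w. g v w * s = ip 1 (f v) (f w)"
    using G2_metricD[OF \<phi>(2)] by blast
  then have lf: "linear f" and inj: "inj f" by (auto simp: adapted_iso_def bij_is_inj)
  have su: "subspace u" using u by (simp add: abelian_ideal_def)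
  obtain n where n: "n \<noteq> 0" "f ` u = {x. ip 1 n x = 0}"
    using hyperplane_normal[of 1 "f ` u"] dim_linear_image[OF lf inj] dims linear_subspace_image[OF lf su]
    by auto
  \<comment> \<open>The index 4 in the signature is attained by an actual negative subspace of
    \<open>u\<close>; its image under \<open>f\<close> lies in the complement of \<open>n\<close>,
    as \<open>normal_positive\<close> requires.\<close>
  obtain W where W: "subspace W" "W \<subseteq> u" "\<And>w. w \<in> W \<Longrightarrow> w \<noteq> 0 \<Longrightarrow> g w w < 0" "dim W = neg_index g u"
    using neg_index_witness[OF su, of g] by blast
  have "ip 1 n n > 0"
  proof (rule normal_positive[OF n(1)])
    show "subspace (f ` W)" using linear_subspace_image[OF lf W(1)] .
    show "dim (f ` W) = 4" using W(4) \<phi>(3) dim_linear_image[OF lf inj] by (simp add: signature_def)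
    show "ip 1 n x = 0" if "x \<in> f ` W" for x using that W(2) n(2) by blast
    show "ip 1 x x < 0" if x: "x \<in> f ` W" "x \<noteq> 0" for x
    proof -
      obtain w where w: "w \<in> W" "x = f w" using x by blast
      then have "w \<noteq> 0" using x linear_0[OF lf] by auto
      then have "g w w * s < 0" using W(3)[OF w(1)] s by (simp add: mult_neg_pos)
      then show ?thesis using g w(2) by simp
    qed
  qed
  then show ?thesis
    using calibrated_imp_complex_block[OF dims br u f7 _ f \<phi>(1) n(2)] by simp
qed

section \<open>From the block form back to calibrated structures\<close>

definition cdet :: "complex \<Rightarrow> complex \<Rightarrow> complex \<Rightarrow> complex \<Rightarrow> complex \<Rightarrow> complex \<Rightarrow> complex \<Rightarrow> complex \<Rightarrow> complex \<Rightarrow> complex" where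
  "cdet x1 x2 x3 y1 y2 y3 z1 z2 z3 =
     x1 * (y2 * z3 - y3 * z2) - x2 * (y1 * z3 - y3 * z1) + x3 * (y1 * z2 - y2 * z1)"

text \<open>A matrix acts on the determinant as a derivation by multiplication with its trace; the
  assumption on \<open>m33\<close> makes the trace zero.\<close>

lemma cdet_derivation:
  assumes "m33 = - m11 - m22"
  shows "cdet (m11 * x1 + m12 * x2 + m13 * x3) (m21 * x1 + m22 * x2 + m23 * x3) (m31 * x1 + m32 * x2 + m33 * x3) y1 y2 y3 z1 z2 z3
    + cdet x1 x2 x3 (m11 * y1 + m12 * y2 + m13 * y3) (m21 * y1 + m22 * y2 + m23 * y3) (m31 * y1 + m32 * y2 + m33 * y3) z1 z2 z3
    + cdet x1 x2 x3 y1 y2 y3 (m11 * z1 + m12 * z2 + m13 * z3) (m21 * z1 + m22 * z2 + m23 * z3) (m31 * z1 + m32 * z2 + m33 * z3)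
    = 0"
  unfolding assms cdet_def by (simp add: algebra_simps)

text \<open>On the hyperplane of the first six coordinates, the model form is the real part of the complex
  determinant in \<open>e\<^sup>1 + \<i> e\<^sup>2\<close>, \<open>e\<^sup>3 + \<i> e\<^sup>4\<close>, \<open>e\<^sup>5 + \<i> e\<^sup>6\<close>.\<close>

lemma tri_eq_cdet:
  assumes "x$7 = 0" "y$7 = 0" "z$7 = 0"
  shows "tri \<epsilon> x y z = Re (cdet (Complex (x$1) (x$2)) (Complex (x$3) (x$4)) (Complex (x$5) (x$6))
    (Complex (y$1) (y$2)) (Complex (y$3) (y$4)) (Complex (y$5) (y$6))
    (Complex (z$1) (z$2)) (Complex (z$3) (z$4)) (Complex (z$5) (z$6)))"
  using assms by (simp add: tri_expand cdet_def algebra_simps)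

text \<open>One map \<open>f\<close> serves all \<epsilon>. It sends \<open>f7\<close> to the
  seventh basis vector and \<open>u\<close> to the first six coordinates, where the monomials
  containing \<epsilon> vanish, and closedness looks only at the restriction to
  \<open>u\<close>.\<close>

lemma complex_block_imp_calibrated:
  fixes br :: "'a::euclidean_space \<Rightarrow> 'a \<Rightarrow> 'a"
  assumes dims: "DIM('a) = 7" "dim u = 6" and br: "lie_algebra br" and u: "abelian_ideal br u" and f7: "f7 \<notin> u"
    and A: "A \<in> carrier_mat 3 3" "mtrace A = 0" and B: "B \<in> carrier_mat 3 3" "mtrace B = 0"
    and b: "ordered_basis 6 u b" and mat: "is_matrix_wrt 6 b (br f7) (four_block_mat A B (- B) A)"
  obtains f where "linear f" "bij f" "u = {x. f x $ 7 = 0}" "\<And>\<epsilon>. calibrated br (\<lambda>x. phi_eps \<epsilon> (f \<circ> x))"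
proof -
  have su: "subspace u" using u by (simp add: abelian_ideal_def)
  have "dim u + 1 = DIM('a)" using dims by simp
  note dec = hyperplane_decomposition[OF su this f7]
  have lT: "linear (br f7)" using br by (simp add: lie_algebra_def)
  have bu: "b i \<in> u" if "i < 6" for i using b that by (simp add: ordered_basis_def)
  \<comment> \<open>The basis is interleaved: \<open>b i\<close> and \<open>b (i + 3)\<close> become
    the real and imaginary directions of one complex coordinate, matching the pairs (1,2), (3,4),
    (5,6) of the model form.\<close>
  define h where "h v = v$1 *\<^sub>R b 0 + v$2 *\<^sub>R b 3 + v$3 *\<^sub>R b 1 + v$4 *\<^sub>R b 4 + v$5 *\<^sub>R b 2 + v$6 *\<^sub>R b 5 + v$7 *\<^sub>R f7"
    for v :: "real^7"
  have S6: "sum F {..<6} = F 0 + F 1 + F 2 + F 3 + F 4 + F 5" for F :: "nat \<Rightarrow> 'a"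
    by (simp add: lessThan_Suc numeral_eq_Suc add_ac)
  have lh: "linear h"
    by (rule linearI) (simp_all add: h_def algebra_simps)
  define cf where "cf v i = (if i = 0 then v$1 else if i = 1 then v$3 else if i = 2 then v$5
      else if i = 3 then v$2 else if i = 4 then v$4 else v$6)" for v :: "real^7" and i :: nat
  have h6: "h v = (\<Sum>i<6. cf v i *\<^sub>R b i) + v$7 *\<^sub>R f7" for v
    unfolding S6 by (simp add: h_def cf_def)
  have sumu: "(\<Sum>i<6. d i *\<^sub>R b i) \<in> u" for d
    using su bu by (intro subspace_sum subspace_scale) auto
  have hu: "h v \<in> u \<longleftrightarrow> v$7 = 0" for v
  proof
    assume "h v \<in> u"
    then have "h v - (\<Sum>i<6. cf v i *\<^sub>R b i) \<in> u" using su sumu by (intro subspace_diff)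
    then have 1: "v$7 *\<^sub>R f7 \<in> u" by (simp add: h6)
    show "v$7 = 0"
    proof (rule ccontr)
      assume "v$7 \<noteq> 0"
      then show False using subspace_scale[OF su 1, of "1 / v$7"] f7 by simp
    qed
  next
    assume "v$7 = 0"
    then show "h v \<in> u" using sumu by (simp add: h6)
  qed
  have "v = 0" if "h v = 0" for v
  proof -
    have 7: "v$7 = 0" using hu[of v] that su by (simp add: subspace_0)
    then have "(\<Sum>i<6. cf v i *\<^sub>R b i) = 0" using h6[of v] that by simp
    then have "cf v i = 0" if "i < 6" for i using ordered_basis_zero[OF b] that by blast
    from this[of 0] this[of 1] this[of 2] this[of 3] this[of 4] this[of 5] show "v = 0"
      using 7 by (simp add: cf_def vec7_eq_iff)
  qed
  then have inj: "inj h" using linear_injective_0[OF lh] by blast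
  have "\<exists>v. x = h v" for x
  proof -
    obtain y t where y: "y \<in> u" "x = y + t *\<^sub>R f7" using dec by blast
    obtain d where d: "y = (\<Sum>i<6. d i *\<^sub>R b i)" using ordered_basis_coords[OF b y(1)] by blast
    define v :: "real^7" where "v = d 0 *\<^sub>R axis 1 1 + d 3 *\<^sub>R axis 2 1 + d 1 *\<^sub>R axis 3 1 + d 4 *\<^sub>R axis 4 1
      + d 2 *\<^sub>R axis 5 1 + d 5 *\<^sub>R axis 6 1 + t *\<^sub>R axis 7 1"
    have "x = h v"
      unfolding y(2) d S6 by (simp add: h_def v_def)
    then show ?thesis ..
  qed
  then have "surj h" by (auto simp: surj_def)
  with inj have bh: "bij h" by (simp add: bij_def)
  define f where "f = inv_into UNIV h"
  have fh: "f (h v) = v" for v using inj by (simp add: f_def)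
  have hf: "h (f x) = x" for x using \<open>surj h\<close> by (simp add: f_def surj_f_inv_f)
  have bf: "bij f" unfolding f_def using bh by (rule bij_imp_bij_inv)
  have lf: "linear f"
  proof (rule linearI)
    show "f (x + y) = f x + f y" for x y
      using fh[of "f x + f y"] by (simp add: linear_add[OF lh] hf)
    show "f (t *\<^sub>R x) = t *\<^sub>R f x" for t x
      using fh[of "t *\<^sub>R f x"] by (simp add: linear_scale[OF lh] hf)
  qed
  have fu: "x \<in> u \<longleftrightarrow> f x $ 7 = 0" for x using hu[of "f x"] by (simp add: hf)
  have Tb: "br f7 (b j) = (\<Sum>i<6. four_block_mat A B (- B) A $$ (i, j) *\<^sub>R b i)" if "j < 6" for j
    using mat that by (simp add: is_matrix_wrt_def)
  have AB: "dim_row A = 3" "dim_col A = 3" "dim_row B = 3" "dim_col B = 3" using A B by auto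
  let ?a = "\<lambda>i j. A $$ (i, j)" and ?b = "\<lambda>i j. B $$ (i, j)"
  have T1: "br f7 (b 0) = ?a 0 0 *\<^sub>R b 0 + ?a 1 0 *\<^sub>R b 1 + ?a 2 0 *\<^sub>R b 2 - ?b 0 0 *\<^sub>R b 3 - ?b 1 0 *\<^sub>R b 4 - ?b 2 0 *\<^sub>R b 5"
    "br f7 (b 1) = ?a 0 1 *\<^sub>R b 0 + ?a 1 1 *\<^sub>R b 1 + ?a 2 1 *\<^sub>R b 2 - ?b 0 1 *\<^sub>R b 3 - ?b 1 1 *\<^sub>R b 4 - ?b 2 1 *\<^sub>R b 5"
    "br f7 (b 2) = ?a 0 2 *\<^sub>R b 0 + ?a 1 2 *\<^sub>R b 1 + ?a 2 2 *\<^sub>R b 2 - ?b 0 2 *\<^sub>R b 3 - ?b 1 2 *\<^sub>R b 4 - ?b 2 2 *\<^sub>R b 5"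
    "br f7 (b 3) = ?b 0 0 *\<^sub>R b 0 + ?b 1 0 *\<^sub>R b 1 + ?b 2 0 *\<^sub>R b 2 + ?a 0 0 *\<^sub>R b 3 + ?a 1 0 *\<^sub>R b 4 + ?a 2 0 *\<^sub>R b 5"
    "br f7 (b 4) = ?b 0 1 *\<^sub>R b 0 + ?b 1 1 *\<^sub>R b 1 + ?b 2 1 *\<^sub>R b 2 + ?a 0 1 *\<^sub>R b 3 + ?a 1 1 *\<^sub>R b 4 + ?a 2 1 *\<^sub>R b 5"
    "br f7 (b 5) = ?b 0 2 *\<^sub>R b 0 + ?b 1 2 *\<^sub>R b 1 + ?b 2 2 *\<^sub>R b 2 + ?a 0 2 *\<^sub>R b 3 + ?a 1 2 *\<^sub>R b 4 + ?a 2 2 *\<^sub>R b 5"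
    by (simp_all add: Tb S6 AB index_mat_four_block)
  \<comment> \<open>The vectors \<open>b 3\<close>, \<open>b 4\<close>, \<open>b 5\<close> are the
    imaginary directions, and \<open>b 0\<close> maps to \<open>A\<close>-terms minus
    \<open>B\<close>-terms in these, so the complex matrix of \<open>br f7\<close> is
    \<open>A - \<i> B\<close>.\<close>
  define m where "m i j = Complex (?a i j) (- ?b i j)" for i j
  have trA: "?a 2 2 = - ?a 0 0 - ?a 1 1" and trB: "?b 2 2 = - ?b 0 0 - ?b 1 1"
    using A(2) B(2) AB by (simp_all add: mtrace_def lessThan_Suc numeral_3_eq_3 numeral_2_eq_2 algebra_simps)
  have m: "m 2 2 = - m 0 0 - m 1 1"
    by (simp add: m_def complex_eq_iff trA trB)
  let ?z1 = "\<lambda>x. Complex (f x $ 1) (f x $ 2)" and ?z2 = "\<lambda>x. Complex (f x $ 3) (f x $ 4)"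
    and ?z3 = "\<lambda>x. Complex (f x $ 5) (f x $ 6)"
  have Tz: "?z1 (br f7 x) = m 0 0 * ?z1 x + m 0 1 * ?z2 x + m 0 2 * ?z3 x"
    "?z2 (br f7 x) = m 1 0 * ?z1 x + m 1 1 * ?z2 x + m 1 2 * ?z3 x"
    "?z3 (br f7 x) = m 2 0 * ?z1 x + m 2 1 * ?z2 x + m 2 2 * ?z3 x" if x: "x \<in> u" for x
  proof -
    let ?v = "f x"
    \<comment> \<open>The real and imaginary parts of \<open>m\<close> applied to the complex
      coordinates of \<open>x\<close>, in interleaved order; \<open>h w\<close> is then compared
      with \<open>br f7 x\<close>.\<close>
    define w :: "real^7" where "w =
        (?a 0 0 * ?v$1 + ?b 0 0 * ?v$2 + ?a 0 1 * ?v$3 + ?b 0 1 * ?v$4 + ?a 0 2 * ?v$5 + ?b 0 2 * ?v$6) *\<^sub>R axis 1 1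
      + (?a 0 0 * ?v$2 - ?b 0 0 * ?v$1 + ?a 0 1 * ?v$4 - ?b 0 1 * ?v$3 + ?a 0 2 * ?v$6 - ?b 0 2 * ?v$5) *\<^sub>R axis 2 1
      + (?a 1 0 * ?v$1 + ?b 1 0 * ?v$2 + ?a 1 1 * ?v$3 + ?b 1 1 * ?v$4 + ?a 1 2 * ?v$5 + ?b 1 2 * ?v$6) *\<^sub>R axis 3 1
      + (?a 1 0 * ?v$2 - ?b 1 0 * ?v$1 + ?a 1 1 * ?v$4 - ?b 1 1 * ?v$3 + ?a 1 2 * ?v$6 - ?b 1 2 * ?v$5) *\<^sub>R axis 4 1
      + (?a 2 0 * ?v$1 + ?b 2 0 * ?v$2 + ?a 2 1 * ?v$3 + ?b 2 1 * ?v$4 + ?a 2 2 * ?v$5 + ?b 2 2 * ?v$6) *\<^sub>R axis 5 1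
      + (?a 2 0 * ?v$2 - ?b 2 0 * ?v$1 + ?a 2 1 * ?v$4 - ?b 2 1 * ?v$3 + ?a 2 2 * ?v$6 - ?b 2 2 * ?v$5) *\<^sub>R axis 6 1"
    have w: "w$1 = ?a 0 0 * ?v$1 + ?b 0 0 * ?v$2 + ?a 0 1 * ?v$3 + ?b 0 1 * ?v$4 + ?a 0 2 * ?v$5 + ?b 0 2 * ?v$6"
      "w$2 = ?a 0 0 * ?v$2 - ?b 0 0 * ?v$1 + ?a 0 1 * ?v$4 - ?b 0 1 * ?v$3 + ?a 0 2 * ?v$6 - ?b 0 2 * ?v$5"
      "w$3 = ?a 1 0 * ?v$1 + ?b 1 0 * ?v$2 + ?a 1 1 * ?v$3 + ?b 1 1 * ?v$4 + ?a 1 2 * ?v$5 + ?b 1 2 * ?v$6"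
      "w$4 = ?a 1 0 * ?v$2 - ?b 1 0 * ?v$1 + ?a 1 1 * ?v$4 - ?b 1 1 * ?v$3 + ?a 1 2 * ?v$6 - ?b 1 2 * ?v$5"
      "w$5 = ?a 2 0 * ?v$1 + ?b 2 0 * ?v$2 + ?a 2 1 * ?v$3 + ?b 2 1 * ?v$4 + ?a 2 2 * ?v$5 + ?b 2 2 * ?v$6"
      "w$6 = ?a 2 0 * ?v$2 - ?b 2 0 * ?v$1 + ?a 2 1 * ?v$4 - ?b 2 1 * ?v$3 + ?a 2 2 * ?v$6 - ?b 2 2 * ?v$5"
      "w$7 = 0"
      by (simp_all add: w_def del: One_nat_def)
    have x7: "?v$7 = 0" using x fu by simp
    have xh: "x = ?v$1 *\<^sub>R b 0 + ?v$2 *\<^sub>R b 3 + ?v$3 *\<^sub>R b 1 + ?v$4 *\<^sub>R b 4 + ?v$5 *\<^sub>R b 2 + ?v$6 *\<^sub>R b 5"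
      using hf[of x] x7 unfolding h_def by simp
    have "br f7 x = ?v$1 *\<^sub>R br f7 (b 0) + ?v$2 *\<^sub>R br f7 (b 3) + ?v$3 *\<^sub>R br f7 (b 1) + ?v$4 *\<^sub>R br f7 (b 4)
        + ?v$5 *\<^sub>R br f7 (b 2) + ?v$6 *\<^sub>R br f7 (b 5)"
      by (subst xh) (simp only: linear_add[OF lT] linear_scale[OF lT])
    also have "\<dots> = h w"
      unfolding T1 h_def w by (simp add: algebra_simps del: One_nat_def)
    finally have fT: "f (br f7 x) = w" by (simp add: fh)
    show "?z1 (br f7 x) = m 0 0 * ?z1 x + m 0 1 * ?z2 x + m 0 2 * ?z3 x"
      "?z2 (br f7 x) = m 1 0 * ?z1 x + m 1 1 * ?z2 x + m 1 2 * ?z3 x"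
      "?z3 (br f7 x) = m 2 0 * ?z1 x + m 2 1 * ?z2 x + m 2 2 * ?z3 x"
      unfolding fT w m_def by (simp_all add: complex_eq_iff del: One_nat_def)
  qed
  have "calibrated br (\<lambda>x. phi_eps \<epsilon> (f \<circ> x))" for \<epsilon>
  proof -
    interpret alternating3 "\<lambda>x y z. tri \<epsilon> (f x) (f y) (f z)"
      using lf by (rule alternating3_tri)
    have "tri \<epsilon> (f (br f7 x)) (f y) (f z) + tri \<epsilon> (f x) (f (br f7 y)) (f z) + tri \<epsilon> (f x) (f y) (f (br f7 z)) = 0"
      if xyz: "x \<in> u" "y \<in> u" "z \<in> u" for x y z
    proof -
      have 7: "f x $ 7 = 0" "f y $ 7 = 0" "f z $ 7 = 0"
        "f (br f7 x) $ 7 = 0" "f (br f7 y) $ 7 = 0" "f (br f7 z) $ 7 = 0"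
        using xyz u by (auto simp: abelian_ideal_def simp flip: fu)
      show ?thesis
        unfolding tri_eq_cdet[OF 7(4,2,3)] tri_eq_cdet[OF 7(1,5,3)] tri_eq_cdet[OF 7(1,2,6)]
          Tz[OF xyz(1)] Tz[OF xyz(2)] Tz[OF xyz(3)] plus_complex.sel(1)[symmetric] cdet_derivation[OF m]
        by simp
    qed
    then show ?thesis
      using calibrated_iff[OF br u dec] by (simp add: phi_eps_eq_tri)
  qed
  then show ?thesis using that lf bf fu by blast
qed

theorem theorem3p1:
  fixes br :: "'a::euclidean_space \<Rightarrow> 'a \<Rightarrow> 'a" and u :: "'a set"
  assumes "DIM('a) = 7"
    and "lie_algebra br"
    and "almost_abelian br"
    and "abelian_ideal br u" and "dim u = 6"
  shows
   "((\<exists>\<phi>. G2_structure (-1) \<phi> \<and> calibrated br \<phi>)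
     \<longleftrightarrow> (\<exists>\<phi> g. G2_structure 1 \<phi> \<and> calibrated br \<phi> \<and> G2_metric 1 \<phi> g \<and> signature g u = (2, 4)))
  \<and> ((\<exists>\<phi> g. G2_structure 1 \<phi> \<and> calibrated br \<phi> \<and> G2_metric 1 \<phi> g \<and> signature g u = (2, 4))
     \<longleftrightarrow> (\<forall>f7. f7 \<notin> u \<longrightarrow>
          (\<exists>A B b. A \<in> carrier_mat 3 3 \<and> B \<in> carrier_mat 3 3 \<and> mtrace A = 0 \<and> mtrace B = 0 \<and>
             ordered_basis 6 u b \<and> is_matrix_wrt 6 b (br f7) (four_block_mat A B (- B) A))))
  \<and> ((\<forall>f7. f7 \<notin> u \<longrightarrow>
          (\<exists>A B b. A \<in> carrier_mat 3 3 \<and> B \<in> carrier_mat 3 3 \<and> mtrace A = 0 \<and> mtrace B = 0 \<and>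
             ordered_basis 6 u b \<and> is_matrix_wrt 6 b (br f7) (four_block_mat A B (- B) A)))
     \<longleftrightarrow> (\<forall>f7. f7 \<notin> u \<longrightarrow> (\<forall>b M. ordered_basis 6 u b \<longrightarrow> is_matrix_wrt 6 b (br f7) M \<longrightarrow>
          (\<exists>n_as :: (nat \<times> complex) list.
             0 \<notin> fst ` set n_as \<and> jordan_matrix n_as \<in> carrier_mat 3 3 \<and>
             mtrace (jordan_matrix n_as) = 0 \<and>
             (\<exists>m_as. mset m_as = mset (n_as @ map (\<lambda>(k, a). (k, cnj a)) n_as) \<and>
                jordan_nf (map_mat complex_of_real M) m_as)))))"
proof -
  note dims = assms(1,5)
  have su: "subspace u" using assms(4) by (simp add: abelian_ideal_def)
  \<comment> \<open>Statements (iii) and (iv) quantify over all elements outside \<open>u\<close>. A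
    concrete such element is needed to draw a conclusion from (iii).\<close>
  have "u \<noteq> UNIV" using dims by auto
  then obtain v where v: "v \<notin> u" by blast
  let ?iii = "\<lambda>f7. \<exists>A B b. A \<in> carrier_mat 3 3 \<and> B \<in> carrier_mat 3 3 \<and> mtrace A = 0 \<and> mtrace B = 0 \<and>
    ordered_basis 6 u b \<and> is_matrix_wrt 6 b (br f7) (four_block_mat A B (- B) A)"
  let ?i = "\<exists>\<phi>. G2_structure (-1) \<phi> \<and> calibrated br \<phi>"
  let ?ii = "\<exists>\<phi> g. G2_structure 1 \<phi> \<and> calibrated br \<phi> \<and> G2_metric 1 \<phi> g \<and> signature g u = (2, 4)"
  have 1: "?iii f7" if "?i" "f7 \<notin> u" for f7
  proof -
    obtain \<phi> where "G2_structure (-1) \<phi>" "calibrated br \<phi>" using \<open>?i\<close> by blast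
    then show ?thesis by (rule G2_imp_complex_block[OF dims assms(2,4) that(2)])
  qed
  have 2: "?iii f7" if "?ii" "f7 \<notin> u" for f7
  proof -
    obtain \<phi> g where "calibrated br \<phi>" "G2_metric 1 \<phi> g" "signature g u = (2, 4)" using \<open>?ii\<close> by blast
    then show ?thesis by (rule G2_star_imp_complex_block[OF dims assms(2,4) that(2)])
  qed
  \<comment> \<open>The block form for the single element \<open>v\<close> gives both structures,
    while each structure gives it for every element outside \<open>u\<close>; this closes the
    cycle.\<close>
  have 3: "?i \<and> ?ii" if "?iii v"
  proof -
    obtain A B b where AB: "A \<in> carrier_mat 3 3" "B \<in> carrier_mat 3 3" "mtrace A = 0" "mtrace B = 0"
        "ordered_basis 6 u b" "is_matrix_wrt 6 b (br v) (four_block_mat A B (- B) A)"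
      using \<open>?iii v\<close> by blast
    obtain f where f: "linear f" "bij f" "u = {x. f x $ 7 = 0}" "\<And>\<epsilon>. calibrated br (\<lambda>x. phi_eps \<epsilon> (f \<circ> x))"
      using complex_block_imp_calibrated[OF dims assms(2,4) v AB(1,3,2,4-6)] by blast
    have ad: "adapted_iso \<epsilon> (\<lambda>x. phi_eps \<epsilon> (f \<circ> x)) f" for \<epsilon>
      using f by (simp add: adapted_iso_def)
    then have st: "G2_structure \<epsilon> (\<lambda>x. phi_eps \<epsilon> (f \<circ> x))" for \<epsilon>
      unfolding G2_structure_def by (rule exI[of _ f])
    show ?thesis
    proof
      show ?i by (intro exI conjI) (rule st, rule f(4))
      show ?ii by (intro exI conjI) (rule st, rule f(4), rule G2_metric_ip[OF ad], rule signature_ip[OF f(1-3)])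
    qed
  qed
  have 4: "?iii f7 \<longleftrightarrow> (\<forall>b M. ordered_basis 6 u b \<longrightarrow> is_matrix_wrt 6 b (br f7) M \<longrightarrow>
          (\<exists>n_as :: (nat \<times> complex) list.
             0 \<notin> fst ` set n_as \<and> jordan_matrix n_as \<in> carrier_mat 3 3 \<and>
             mtrace (jordan_matrix n_as) = 0 \<and>
             (\<exists>m_as. mset m_as = mset (n_as @ map (\<lambda>(k, a). (k, cnj a)) n_as) \<and>
                jordan_nf (map_mat complex_of_real M) m_as)))" for f7
  proof (rule complex_block_iff_jordan[OF su dims(2)])
    show "linear (br f7)" using assms(2) by (simp add: lie_algebra_def)
    show "br f7 x \<in> u" if "x \<in> u" for x using assms(4) that by (simp add: abelian_ideal_def)
  qed
  have 5: "?i \<longleftrightarrow> ?ii"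
  proof
    show ?ii if ?i by (rule conjunct2[OF 3[OF 1[OF that v]]])
    show ?i if ?ii by (rule conjunct1[OF 3[OF 2[OF that v]]])
  qed
  have 6: "?ii \<longleftrightarrow> (\<forall>f7. f7 \<notin> u \<longrightarrow> ?iii f7)"
  proof
    show "\<forall>f7. f7 \<notin> u \<longrightarrow> ?iii f7" if ?ii
      using 2[OF that] by (intro allI impI)
    show ?ii if "\<forall>f7. f7 \<notin> u \<longrightarrow> ?iii f7"
      by (rule conjunct2[OF 3[OF that[rule_format, OF v]]])
  qed
  show ?thesis
    by (rule conjI[OF 5 conjI[OF 6]]) (simp only: 4)
qed

end
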